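(* Let $(M,\tilde g)$ be a signature-type changing manifold of dimension $n\ge 2$, with degeneracy locus $\mathcal H$. Then for every point $p_0\in M$ there exists an open neighborhood $U$ of $p_0$ such that the following are equivalent: (1) on $U$, $\tilde g$ is a transverse type-changing metric with a transverse radical; (2) on $U$, $\tilde g$ is obtained from a Lorentzian metric via the Transformation Prescription, i.e. there exist a Lorentzian metric $g$ on $U$, a smooth non-vanishing line element field $\{V,-V\}$ on $U$ with $g(V,V)=-1$, and a smooth function $f\colon U\to\mathbb R$ such that $\tilde g|_U=g+f\,V^\flat\otimes V^\flat$, and such that for all $q\in f^{-1}(1)=\mathcal H\cap U$ $$df(q)\neq 0\quad\text{and}\quad (df(V))(q)\neq 0 .$$
   Context: Manifolds are smooth, connected, second countable, Hausdorff and without boundary; Lorentzian metrics have signature $(-,+,\ldots,+)$. A signature-type changing manifold $(M,\tilde g)$ is a manifold $M$ with a smooth symmetric $(0,2)$-tensor field $\tilde g$ such that the set $\mathcal H=\{q\in M:\tilde g|_q\text{ is degenerate}\}$ is non-empty, one connected component $M_R$ of $M\setminus\mathcal H$ is Riemannian ($\tilde g$ positive definite), and all other connected components of $M\setminus\mathcal H$ are Lorentzian (their union is $M_L$). On an open set $U\subseteq M$, $\tilde g$ is a transverse type-changing metric if for every $q\in\mathcal H\cap U$ and every local coordinate system around $q$, $d(\det[\tilde g_{\mu\nu}])_q\neq 0$. In that case $\mathcal H\cap U$ is a smoothly embedded hypersurface and for $q\in\mathcal H\cap U$ the radical $\mathrm{Rad}_q=\{w\in T_qM:\tilde g(w,\cdot)=0\}$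 is one-dimensional; the radical is called transverse (on $U$) if $\mathrm{Rad}_q\oplus T_q\mathcal H=T_qM$ for every $q\in\mathcal H\cap U$. A smooth non-vanishing line element field is a smooth assignment to each point $p$ of an unordered pair $\{V_p,-V_p\}$ of opposite nonzero tangent vectors. $V^\flat=g(V,\cdot)$ is taken with respect to $g$, so $V^\flat\otimes V^\flat$ is independent of the choice of sign, as is the condition $df(V)\ne0$. *)

theory Defs
  imports "HOL-Analysis.Analysis"
begin

section \<open>Smooth maps on open subsets of Euclidean spaces\<close>

text \<open>These notions are only meaningful, and only used below, for open sets \<open>S\<close>.\<close>

primrec Ck_on :: "nat \<Rightarrow> 'b::euclidean_space set \<Rightarrow> ('b \<Rightarrow> 'c::real_normed_vector) \<Rightarrow> bool" where
  "Ck_on 0 S f \<longleftrightarrow> continuous_on S f"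
| "Ck_on (Suc k) S f \<longleftrightarrow>
     (\<forall>x\<in>S. f differentiable (at x)) \<and>
     (\<forall>v. Ck_on k S (\<lambda>x. frechet_derivative f (at x) v))"

definition smooth_on :: "'b::euclidean_space set \<Rightarrow> ('b \<Rightarrow> 'c::real_normed_vector) \<Rightarrow> bool" where
  "smooth_on S f \<longleftrightarrow> (\<forall>k. Ck_on k S f)"


section \<open>Smooth manifolds of dimension \<open>CARD('n)\<close>\<close>

text \<open>The value of \<open>coord c\<close> outside \<open>cdom c\<close> is irrelevant.\<close>

datatype ('a, 'n) chart = Chart (cdom: "'a set") (coord: "'a \<Rightarrow> real^'n")

definition chart_inv :: "('a, 'n::finite) chart \<Rightarrow> real^'n \<Rightarrow> 'a" where
  "chart_inv c = inv_into (cdom c) (coord c)"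

definition transition :: "('a, 'n::finite) chart \<Rightarrow> ('a, 'n) chart \<Rightarrow> real^'n \<Rightarrow> real^'n" where
  "transition c c' = coord c' \<circ> chart_inv c"

definition topological_chart :: "'a topology \<Rightarrow> ('a, 'n::finite) chart \<Rightarrow> bool" where
  "topological_chart X c \<longleftrightarrow>
     openin X (cdom c) \<and> open (coord c ` cdom c) \<and>
     homeomorphic_map (subtopology X (cdom c)) (top_of_set (coord c ` cdom c)) (coord c)"

definition compatible :: "('a, 'n::finite) chart \<Rightarrow> ('a, 'n) chart \<Rightarrow> bool" where
  "compatible c c' \<longleftrightarrow>
     smooth_on (coord c ` (cdom c \<inter> cdom c')) (transition c c') \<and>
     smooth_on (coord c' ` (cdom c \<inter> cdom c')) (transition c' c)"

text \<open>The atlas is maximal, so that it consists of all local coordinate systems.\<close>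

definition smooth_structure :: "'a topology \<Rightarrow> ('a, 'n::finite) chart set \<Rightarrow> bool" where
  "smooth_structure X A \<longleftrightarrow>
     (\<forall>c\<in>A. topological_chart X c) \<and>
     (\<Union>c\<in>A. cdom c) = topspace X \<and>
     (\<forall>c\<in>A. \<forall>c'\<in>A. compatible c c') \<and>
     (\<forall>c. topological_chart X c \<and> (\<forall>c'\<in>A. compatible c c') \<longrightarrow> c \<in> A)"

definition smooth_manifold :: "'a topology \<Rightarrow> ('a, 'n::finite) chart set \<Rightarrow> bool" where
  "smooth_manifold X A \<longleftrightarrow>
     Hausdorff_space X \<and> second_countable X \<and> connected_space X \<and> smooth_structure X A"

definition charts_at :: "('a, 'n::finite) chart set \<Rightarrow> 'a \<Rightarrow> ('a, 'n) chart set" where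
  "charts_at A p = {c \<in> A. p \<in> cdom c}"

definition smooth_fun :: "('a, 'n::finite) chart set \<Rightarrow> 'a set \<Rightarrow> ('a \<Rightarrow> real) \<Rightarrow> bool" where
  "smooth_fun A U f \<longleftrightarrow> (\<forall>c\<in>A. smooth_on (coord c ` (cdom c \<inter> U)) (f \<circ> chart_inv c))"


section \<open>Tangent vectors\<close>

text \<open>A tangent vector at \<open>p\<close> assigns to every chart around \<open>p\<close> a component vector; the
  components in different charts are related by the differential of the change of coordinates.
  The value \<open>0\<close> at all other charts is a normalisation which makes equality of tangent vectors at
  \<open>p\<close> equality of functions. The vector space operations on \<open>T\<^sub>pM\<close> are the pointwise ones.\<close>

type_synonym ('a, 'n) tvec = "('a, 'n) chart \<Rightarrow> real^'n"

definition tangent_space :: "('a, 'n::finite) chart set \<Rightarrow> 'a \<Rightarrow> ('a, 'n) tvec set" where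
  "tangent_space A p =
     {w. (\<forall>c\<in>charts_at A p. \<forall>c'\<in>charts_at A p.
            w c' = frechet_derivative (transition c c') (at (coord c p)) (w c)) \<and>
         (\<forall>c. c \<notin> charts_at A p \<longrightarrow> w c = 0)}"

abbreviation tv_zero :: "('a, 'n::finite) tvec" where
  "tv_zero \<equiv> (\<lambda>_. 0)"

definition tv_add :: "('a, 'n::finite) tvec \<Rightarrow> ('a, 'n) tvec \<Rightarrow> ('a, 'n) tvec" where
  "tv_add u v = (\<lambda>c. u c + v c)"

definition tv_scale :: "real \<Rightarrow> ('a, 'n::finite) tvec \<Rightarrow> ('a, 'n) tvec" where
  "tv_scale a v = (\<lambda>c. a *\<^sub>R v c)"

definition tv_minus :: "('a, 'n::finite) tvec \<Rightarrow> ('a, 'n) tvec" where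
  "tv_minus v = (\<lambda>c. - v c)"

text \<open>The coordinate vector \<open>\<partial>\<^sub>i\<close> of the chart \<open>c\<close> at \<open>p\<close>.\<close>

definition coord_vec :: "('a, 'n::finite) chart set \<Rightarrow> ('a, 'n) chart \<Rightarrow> 'a \<Rightarrow> 'n \<Rightarrow> ('a, 'n) tvec" where
  "coord_vec A c p i =
     (\<lambda>c'. if c' \<in> charts_at A p
           then frechet_derivative (transition c c') (at (coord c p)) (axis i 1) else 0)"

text \<open>\<open>df\<^sub>p(w)\<close>, computed in an arbitrary chart around \<open>p\<close>. For \<open>w \<in> T\<^sub>pM\<close> and \<open>f\<close> differentiable
  near \<open>p\<close> the chain rule shows that the chart does not matter.\<close>

definition differential :: "('a, 'n::finite) chart set \<Rightarrow> ('a \<Rightarrow> real) \<Rightarrow> 'a \<Rightarrow> ('a, 'n) tvec \<Rightarrow> real" where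
  "differential A f p w =
     (let c = (SOME c. c \<in> charts_at A p)
      in frechet_derivative (f \<circ> chart_inv c) (at (coord c p)) (w c))"

definition differential_nonzero :: "('a, 'n::finite) chart set \<Rightarrow> ('a \<Rightarrow> real) \<Rightarrow> 'a \<Rightarrow> bool" where
  "differential_nonzero A f p \<longleftrightarrow> (\<exists>w\<in>tangent_space A p. differential A f p w \<noteq> 0)"

definition smooth_vector_field ::
    "('a, 'n::finite) chart set \<Rightarrow> 'a set \<Rightarrow> ('a \<Rightarrow> ('a, 'n) tvec) \<Rightarrow> bool" where
  "smooth_vector_field A W V \<longleftrightarrow>
     (\<forall>p\<in>W. V p \<in> tangent_space A p) \<and>
     (\<forall>c\<in>A. smooth_on (coord c ` (cdom c \<inter> W)) (\<lambda>x. V (chart_inv c x) c))"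

text \<open>Smoothness of a line element field means that locally one can choose the sign so as to obtain
  a smooth vector field; no global choice of sign is required.\<close>

definition line_element_field ::
    "'a topology \<Rightarrow> ('a, 'n::finite) chart set \<Rightarrow> 'a set \<Rightarrow> ('a \<Rightarrow> ('a, 'n) tvec set) \<Rightarrow> bool" where
  "line_element_field X A U L \<longleftrightarrow>
     (\<forall>p\<in>U. \<exists>W V. openin X W \<and> p \<in> W \<and> W \<subseteq> U \<and> smooth_vector_field A W V \<and>
        (\<forall>q\<in>W. V q \<noteq> tv_zero \<and> L q = {V q, tv_minus (V q)}))"

definition smooth_curve ::
    "'a topology \<Rightarrow> ('a, 'n::finite) chart set \<Rightarrow> real \<Rightarrow> (real \<Rightarrow> 'a) \<Rightarrow> bool" where
  "smooth_curve X A e \<gamma> \<longleftrightarrow>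
     continuous_map (top_of_set {-e<..<e}) X \<gamma> \<and>
     (\<forall>c\<in>A. smooth_on {t \<in> {-e<..<e}. \<gamma> t \<in> cdom c} (coord c \<circ> \<gamma>))"

text \<open>For an embedded submanifold \<open>S\<close>, its tangent space at \<open>q \<in> S\<close>, consisting of the velocities of
  the smooth curves in \<open>S\<close> through \<open>q\<close>. Only a neighbourhood of \<open>q\<close> in \<open>S\<close> matters.\<close>

definition tangent_space_of ::
    "'a topology \<Rightarrow> ('a, 'n::finite) chart set \<Rightarrow> 'a set \<Rightarrow> 'a \<Rightarrow> ('a, 'n) tvec set" where
  "tangent_space_of X A S q =
     {w \<in> tangent_space A q. \<exists>e>0. \<exists>\<gamma>. smooth_curve X A e \<gamma> \<and> \<gamma> 0 = q \<and> \<gamma> ` {-e<..<e} \<subseteq> S \<and>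
        (\<forall>c\<in>charts_at A q. ((coord c \<circ> \<gamma>) has_vector_derivative w c) (at 0))}"


section \<open>Symmetric tensor fields and metrics\<close>

type_synonym ('a, 'n) tensor2 = "'a \<Rightarrow> ('a, 'n) tvec \<Rightarrow> ('a, 'n) tvec \<Rightarrow> real"

definition symmetric_bilinear ::
    "('a, 'n::finite) chart set \<Rightarrow> 'a \<Rightarrow> (('a, 'n) tvec \<Rightarrow> ('a, 'n) tvec \<Rightarrow> real) \<Rightarrow> bool" where
  "symmetric_bilinear A p B \<longleftrightarrow>
     (\<forall>u\<in>tangent_space A p. \<forall>v\<in>tangent_space A p. B u v = B v u) \<and>
     (\<forall>u\<in>tangent_space A p. \<forall>v\<in>tangent_space A p. \<forall>w\<in>tangent_space A p.
        B (tv_add u v) w = B u w + B v w) \<and>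
     (\<forall>a. \<forall>u\<in>tangent_space A p. \<forall>w\<in>tangent_space A p. B (tv_scale a u) w = a * B u w)"

definition components ::
    "('a, 'n::finite) chart set \<Rightarrow> ('a, 'n) tensor2 \<Rightarrow> ('a, 'n) chart \<Rightarrow> 'a \<Rightarrow> real^'n^'n" where
  "components A g c p = (\<chi> i j. g p (coord_vec A c p i) (coord_vec A c p j))"

definition symmetric_tensor_field ::
    "('a, 'n::finite) chart set \<Rightarrow> 'a set \<Rightarrow> ('a, 'n) tensor2 \<Rightarrow> bool" where
  "symmetric_tensor_field A U g \<longleftrightarrow>
     (\<forall>p\<in>U. symmetric_bilinear A p (g p)) \<and>
     (\<forall>c\<in>A. \<forall>i j. smooth_on (coord c ` (cdom c \<inter> U)) (\<lambda>x. components A g c (chart_inv c x) $ i $ j))"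

definition positive_definite_at :: "('a, 'n::finite) chart set \<Rightarrow> ('a, 'n) tensor2 \<Rightarrow> 'a \<Rightarrow> bool" where
  "positive_definite_at A g p \<longleftrightarrow> (\<forall>w\<in>tangent_space A p. w \<noteq> tv_zero \<longrightarrow> g p w w > 0)"

text \<open>Signature \<open>(-,+,\<dots>,+)\<close>: there is a pseudo-orthonormal basis \<open>e\<close> with exactly one timelike
  vector. That the \<open>CARD('n)\<close> vectors \<open>e i\<close> form a basis follows from the orthogonality relations.\<close>

definition lorentzian_at :: "('a, 'n::finite) chart set \<Rightarrow> ('a, 'n) tensor2 \<Rightarrow> 'a \<Rightarrow> bool" where
  "lorentzian_at A g p \<longleftrightarrow>
     (\<exists>e :: 'n \<Rightarrow> ('a, 'n) tvec. \<exists>k. (\<forall>i. e i \<in> tangent_space A p) \<and>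
        (\<forall>i j. g p (e i) (e j) = (if i \<noteq> j then 0 else if i = k then -1 else 1)))"

definition lorentzian_metric ::
    "('a, 'n::finite) chart set \<Rightarrow> 'a set \<Rightarrow> ('a, 'n) tensor2 \<Rightarrow> bool" where
  "lorentzian_metric A U g \<longleftrightarrow> symmetric_tensor_field A U g \<and> (\<forall>p\<in>U. lorentzian_at A g p)"

definition flat :: "('a, 'n::finite) tensor2 \<Rightarrow> 'a \<Rightarrow> ('a, 'n) tvec \<Rightarrow> ('a, 'n) tvec \<Rightarrow> real" where
  "flat g p v = (\<lambda>w. g p v w)"


section \<open>Signature-type change\<close>

definition radical :: "('a, 'n::finite) chart set \<Rightarrow> ('a, 'n) tensor2 \<Rightarrow> 'a \<Rightarrow> ('a, 'n) tvec set" where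
  "radical A g q = {w \<in> tangent_space A q. \<forall>v\<in>tangent_space A q. g q w v = 0}"

definition degeneracy_locus ::
    "'a topology \<Rightarrow> ('a, 'n::finite) chart set \<Rightarrow> ('a, 'n) tensor2 \<Rightarrow> 'a set" where
  "degeneracy_locus X A g = {q \<in> topspace X. radical A g q \<noteq> {tv_zero}}"

definition signature_type_changing ::
    "'a topology \<Rightarrow> ('a, 'n::finite) chart set \<Rightarrow> ('a, 'n) tensor2 \<Rightarrow> bool" where
  "signature_type_changing X A g \<longleftrightarrow>
     symmetric_tensor_field A (topspace X) g \<and>
     degeneracy_locus X A g \<noteq> {} \<and>
     (let Comps = connected_components_of (subtopology X (topspace X - degeneracy_locus X A g))
      in \<exists>M\<^sub>R\<in>Comps. (\<forall>q\<in>M\<^sub>R. positive_definite_at A g q) \<and>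
           (\<forall>C\<in>Comps - {M\<^sub>R}. \<forall>q\<in>C. lorentzian_at A g q))"

definition transverse_type_changing ::
    "'a topology \<Rightarrow> ('a, 'n::finite) chart set \<Rightarrow> 'a set \<Rightarrow> ('a, 'n) tensor2 \<Rightarrow> bool" where
  "transverse_type_changing X A U g \<longleftrightarrow>
     (\<forall>q\<in>degeneracy_locus X A g \<inter> U. \<forall>c\<in>charts_at A q.
        differential_nonzero A (\<lambda>p. det (components A g c p)) q)"

text \<open>\<open>Rad\<^sub>q \<oplus> T\<^sub>q\<H> = T\<^sub>qM\<close> is an internal direct sum: existence and uniqueness of decompositions.\<close>

definition transverse_radical ::
    "'a topology \<Rightarrow> ('a, 'n::finite) chart set \<Rightarrow> 'a set \<Rightarrow> ('a, 'n) tensor2 \<Rightarrow> bool" where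
  "transverse_radical X A U g \<longleftrightarrow>
     (\<forall>q\<in>degeneracy_locus X A g \<inter> U. \<forall>w\<in>tangent_space A q.
        \<exists>!(u, v). u \<in> radical A g q \<and>
          v \<in> tangent_space_of X A (degeneracy_locus X A g \<inter> U) q \<and> w = tv_add u v)"

text \<open>\<open>gt\<close> is obtained on \<open>U\<close> from the Lorentzian metric \<open>g\<close>, the line element field \<open>L = {V, -V}\<close>
  and the function \<open>f\<close>. Both representatives \<open>v \<in> L p\<close> are quantified over; since
  \<open>V\<^sup>\<flat> \<otimes> V\<^sup>\<flat>\<close> and \<open>df(V) \<noteq> 0\<close> do not depend on the sign, one could equally use either.\<close>

definition transformation_prescription ::
    "'a topology \<Rightarrow> ('a, 'n::finite) chart set \<Rightarrow> 'a set \<Rightarrow> ('a, 'n) tensor2 \<Rightarrow>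
     ('a, 'n) tensor2 \<Rightarrow> ('a \<Rightarrow> ('a, 'n) tvec set) \<Rightarrow> ('a \<Rightarrow> real) \<Rightarrow> bool" where
  "transformation_prescription X A U gt g L f \<longleftrightarrow>
     lorentzian_metric A U g \<and>
     line_element_field X A U L \<and>
     (\<forall>p\<in>U. \<forall>v\<in>L p. g p v v = -1) \<and>
     smooth_fun A U f \<and>
     (\<forall>p\<in>U. \<forall>v\<in>L p. \<forall>x\<in>tangent_space A p. \<forall>y\<in>tangent_space A p.
        gt p x y = g p x y + f p * (flat g p v x * flat g p v y))"

end

theory Submission
  imports Defs
begin

text \<open>
  Write \<open>G\<close> for the component matrix of \<open>gt\<close> in a chart, \<open>D = det G\<close>, and let \<open>adj G\<close> be its adjugate.

  If \<open>gt\<close> is transverse with transverse radical, put \<open>V = adj G b\<close> for a suitable constant covector \<open>b\<close>,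
  so that \<open>G V = D b\<close>. With \<open>\<beta> = b \<bullet> V > 0\<close>, \<open>f = 1 + \<beta> D\<close> and \<open>\<omega> = - b / \<beta>\<close>, the tensor
  \<open>g = gt - f \<omega> \<otimes> \<omega>\<close> satisfies \<open>g(V, \<cdot>) = \<omega>\<close> and \<open>g(V, V) = -1\<close>, and it agrees with \<open>gt\<close> on the
  hyperplane \<open>b\<^sup>\<bottom>\<close>. Hence \<open>g\<close> is Lorentzian near \<open>p0\<close> as soon as at \<open>p0\<close> both \<open>b \<bullet> adj G b > 0\<close>
  and \<open>G\<close> is positive definite on \<open>b\<^sup>\<bottom>\<close>. At a Riemannian point every \<open>b \<noteq> 0\<close> will do, at a Lorentzian
  point \<open>b = G u\<close> with \<open>u\<close> timelike, and at a degenerate point \<open>b\<close> spanning the radical; there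
  semidefiniteness is inherited from nearby Riemannian points, which exist because \<open>dD \<noteq> 0\<close>. Along
  \<open>D = 0\<close> the field \<open>V\<close> spans the radical and \<open>df = \<beta> dD\<close>, so transversality gives \<open>df(V) \<noteq> 0\<close>.

  Conversely \<open>det gt = (1 - f) det g\<close>, so \<open>dD = - det g df\<close> on \<open>f = 1\<close>, where \<open>V\<close> spans the radical. The
  kernel of \<open>df\<close> is the tangent space of the level set by the inverse function theorem, and
  \<open>df(V) \<noteq> 0\<close> makes the decomposition direct.
\<close>

section \<open>Calculus of smooth maps\<close>

lemma Ck_on_cong:
  assumes "open S" "\<And>x. x \<in> S \<Longrightarrow> f x = g x" "Ck_on k S f"
  shows "Ck_on k S g"
  using assms(2,3)
proof (induction k arbitrary: f g)
  case 0
  then show ?case by (simp cong: continuous_on_cong)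
next
  case (Suc k)
  \<comment> \<open>Since \<open>S\<close> is open, the derivative at a point of \<open>S\<close>
    depends only on the values taken on \<open>S\<close>. So the agreement of \<open>f\<close> and
    \<open>g\<close> passes to all directional derivatives and the induction can continue.\<close>
  have D: "(g has_derivative frechet_derivative f (at x)) (at x)" if "x \<in> S" for x
  proof (rule has_derivative_transform_within_open[OF _ assms(1) that])
    show "(f has_derivative frechet_derivative f (at x)) (at x)"
      using that Suc.prems(2) by (auto simp flip: frechet_derivative_works)
  qed (use Suc.prems(1) in auto)
  then have eq: "frechet_derivative f (at x) = frechet_derivative g (at x)" if "x \<in> S" for x
    using that frechet_derivative_at by blast
  show ?case
    using Suc.prems(2) D Suc.IH[of "\<lambda>x. frechet_derivative f (at x) v" "\<lambda>x. frechet_derivative g (at x) v" for v]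
    by (auto simp: differentiable_def eq)
qed

text \<open>Lets the derivative be given by an explicit formula; uniqueness of derivatives
  identifies it with \<open>frechet_derivative\<close>.\<close>

lemma Ck_on_SucI:
  assumes "open S" "\<And>x. x \<in> S \<Longrightarrow> (f has_derivative f' x) (at x)" "\<And>v. Ck_on k S (\<lambda>x. f' x v)"
  shows "Ck_on (Suc k) S f"
proof -
  have "f' x = frechet_derivative f (at x)" if "x \<in> S" for x
    using assms(2)[OF that] frechet_derivative_at by blast
  then show ?thesis
    using assms Ck_on_cong[OF assms(1) _ assms(3)] by (auto simp: differentiable_def)
qed

lemma Ck_on_subset: "Ck_on k S f \<Longrightarrow> T \<subseteq> S \<Longrightarrow> Ck_on k T f"
  by (induction k arbitrary: f) (auto intro: continuous_on_subset)

lemma Ck_on_SucD: "Ck_on (Suc k) S f \<Longrightarrow> Ck_on k S f"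
proof (induction k arbitrary: f)
  case 0
  then show ?case
    by (auto intro!: continuous_at_imp_continuous_on differentiable_imp_continuous_within)
qed (auto intro!: continuous_at_imp_continuous_on differentiable_imp_continuous_within)

lemma Ck_on_has_derivative:
  "Ck_on (Suc k) S f \<Longrightarrow> x \<in> S \<Longrightarrow> (f has_derivative frechet_derivative f (at x)) (at x)"
  by (auto simp: frechet_derivative_works)

lemma Ck_on_const: "open S \<Longrightarrow> Ck_on k S (\<lambda>x. c)"
  by (induction k arbitrary: c) auto

lemma Ck_on_linear_comp:
  assumes "open S" "bounded_linear h" "Ck_on k S f"
  shows "Ck_on k S (\<lambda>x. h (f x))"
  using assms(3)
proof (induction k arbitrary: f)
  case 0
  then show ?case using assms(2) by (auto intro: bounded_linear.continuous_on)
next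
  case (Suc k)
  show ?case
  proof (rule Ck_on_SucI[OF assms(1)])
    fix x assume "x \<in> S"
    then show "((\<lambda>x. h (f x)) has_derivative (\<lambda>v. h (frechet_derivative f (at x) v))) (at x)"
      using bounded_linear.has_derivative[OF assms(2) Ck_on_has_derivative[OF Suc.prems]] by blast
  next
    fix v show "Ck_on k S (\<lambda>x. h (frechet_derivative f (at x) v))"
      using Suc by auto
  qed
qed

lemma Ck_on_add:
  assumes "open S" "Ck_on k S f" "Ck_on k S g"
  shows "Ck_on k S (\<lambda>x. f x + g x)"
  using assms(2,3)
proof (induction k arbitrary: f g)
  case (Suc k)
  show ?case
  proof (rule Ck_on_SucI[OF assms(1)])
    fix x assume "x \<in> S"
    then show "((\<lambda>x. f x + g x) has_derivative
        (\<lambda>v. frechet_derivative f (at x) v + frechet_derivative g (at x) v)) (at x)"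
      using Ck_on_has_derivative[OF Suc.prems(1)] Ck_on_has_derivative[OF Suc.prems(2)]
      by (intro has_derivative_add)
  qed (use Suc in auto)
qed (auto intro: continuous_intros)

text \<open>One product rule serves scalar multiples, real products and inner products. Each summand
  of the derivative is again a product by \<open>p\<close>, with one factor differentiated and the
  other merely lowered by one order of differentiability.\<close>

lemma Ck_on_bilinear:
  assumes "open S" "bounded_bilinear p" "Ck_on k S f" "Ck_on k S g"
  shows "Ck_on k S (\<lambda>x. p (f x) (g x))"
  using assms(3,4)
proof (induction k arbitrary: f g)
  case 0
  then show ?case using assms(2) by (auto intro: bounded_bilinear.continuous_on)
next
  case (Suc k)
  show ?case
  proof (rule Ck_on_SucI[OF assms(1)])
    fix x assume "x \<in> S"
    then show "((\<lambda>x. p (f x) (g x)) has_derivative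
        (\<lambda>v. p (f x) (frechet_derivative g (at x) v) + p (frechet_derivative f (at x) v) (g x))) (at x)"
      using Ck_on_has_derivative[OF Suc.prems(1)] Ck_on_has_derivative[OF Suc.prems(2)]
      by (intro bounded_bilinear.FDERIV[OF assms(2)])
  next
    fix v
    show "Ck_on k S (\<lambda>x. p (f x) (frechet_derivative g (at x) v) + p (frechet_derivative f (at x) v) (g x))"
      using Suc.prems Ck_on_SucD[OF Suc.prems(1)] Ck_on_SucD[OF Suc.prems(2)]
      by (intro Ck_on_add assms(1) Suc.IH) auto
  qed
qed

lemma Ck_on_sum:
  "open S \<Longrightarrow> (\<And>i. i \<in> I \<Longrightarrow> Ck_on k S (f i)) \<Longrightarrow> Ck_on k S (\<lambda>x. \<Sum>i\<in>I. f i x)"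
  by (induction I rule: infinite_finite_induct) (auto intro: Ck_on_const Ck_on_add)

text \<open>By the chain rule the derivative of \<open>g\<close> is applied in the moving direction
  \<open>f' x v\<close>, while \<open>Ck_on\<close> controls derivatives in fixed directions only.
  Expanding \<open>f' x v\<close> over \<open>Basis\<close> reduces the former to the
  latter.\<close>

lemma Ck_on_compose:
  fixes f :: "'a::euclidean_space \<Rightarrow> 'b::euclidean_space"
  assumes "open S" "open T" "f ` S \<subseteq> T" "Ck_on k T g" "Ck_on k S f"
  shows "Ck_on k S (\<lambda>x. g (f x))"
  using assms(4,5)
proof (induction k arbitrary: g)
  case 0
  then show ?case using assms(3) by (auto intro: continuous_on_compose2)
next
  case (Suc k)
  define f' where "f' = (\<lambda>x. frechet_derivative f (at x))"
  define g' where "g' = (\<lambda>y. frechet_derivative g (at y))"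
  have g: "(g has_derivative g' (f x)) (at (f x))" if "x \<in> S" for x
    using Ck_on_has_derivative[OF Suc.prems(1)] that assms(3) unfolding g'_def by auto
  have f: "(f has_derivative f' x) (at x)" if "x \<in> S" for x
    using Ck_on_has_derivative[OF Suc.prems(2) that] unfolding f'_def .
  show ?case
  proof (rule Ck_on_SucI[OF assms(1)])
    fix x assume x: "x \<in> S"
    have "((g \<circ> f) has_derivative (g' (f x) \<circ> f' x)) (at x)"
      using diff_chain_at[OF f[OF x] g[OF x]] .
    moreover have "g' (f x) \<circ> f' x = (\<lambda>v. \<Sum>b\<in>Basis. (f' x v \<bullet> b) *\<^sub>R g' (f x) b)"
    proof
      fix v
      have "linear (g' (f x))" using g[OF x] has_derivative_linear by blast
      then have "g' (f x) (\<Sum>b\<in>Basis. (f' x v \<bullet> b) *\<^sub>R b) = (\<Sum>b\<in>Basis. (f' x v \<bullet> b) *\<^sub>R g' (f x) b)"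
        by (simp add: linear_sum linear_cmul)
      then show "(g' (f x) \<circ> f' x) v = (\<Sum>b\<in>Basis. (f' x v \<bullet> b) *\<^sub>R g' (f x) b)"
        by (simp add: euclidean_representation)
    qed
    ultimately show "((\<lambda>x. g (f x)) has_derivative
        (\<lambda>v. \<Sum>b\<in>Basis. (f' x v \<bullet> b) *\<^sub>R g' (f x) b)) (at x)"
      by (simp add: o_def)
  next
    fix v
    have "Ck_on k S (\<lambda>x. g' (f x) b)" for b
      using Suc.IH[of "\<lambda>y. g' y b"] Suc.prems Ck_on_SucD unfolding g'_def by auto
    moreover have "Ck_on k S (\<lambda>x. f' x v \<bullet> b)" for b
      using Suc.prems(2) unfolding f'_def
      by (intro Ck_on_linear_comp[OF assms(1) bounded_linear_inner_left]) simp
    ultimately show "Ck_on k S (\<lambda>x. \<Sum>b\<in>Basis. (f' x v \<bullet> b) *\<^sub>R g' (f x) b)"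
      by (intro Ck_on_sum Ck_on_bilinear[where p = "(*\<^sub>R)"] assms(1) bounded_bilinear_scaleR)
  qed
qed

text \<open>The derivative of \<open>inverse f\<close> is a product of \<open>inverse f\<close>,
  \<open>f'\<close> and \<open>inverse f\<close>, so the induction hypothesis on
  \<open>inverse f\<close> itself closes the argument.\<close>

lemma Ck_on_inverse:
  fixes f :: "'a::euclidean_space \<Rightarrow> real"
  assumes "open S" "\<And>x. x \<in> S \<Longrightarrow> f x \<noteq> 0" "Ck_on k S f"
  shows "Ck_on k S (\<lambda>x. inverse (f x))"
  using assms(3)
proof (induction k)
  case 0
  then show ?case using assms(2) by (auto intro: continuous_on_inverse)
next
  case (Suc k)
  show ?case
  proof (rule Ck_on_SucI[OF assms(1)])
    fix x assume x: "x \<in> S"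
    show "((\<lambda>x. inverse (f x)) has_derivative
        (\<lambda>v. - (inverse (f x) * frechet_derivative f (at x) v * inverse (f x)))) (at x)"
      using Deriv.has_derivative_inverse[OF assms(2)[OF x] Ck_on_has_derivative[OF Suc.prems x]] by simp
  next
    fix v
    have "Ck_on k S (\<lambda>x. inverse (f x))" "Ck_on k S (\<lambda>x. frechet_derivative f (at x) v)"
      using Suc Ck_on_SucD by auto
    then show "Ck_on k S (\<lambda>x. - (inverse (f x) * frechet_derivative f (at x) v * inverse (f x)))"
      by (intro Ck_on_linear_comp[OF assms(1) bounded_linear_minus[OF bounded_linear_ident]]
          Ck_on_bilinear[OF assms(1) bounded_bilinear_mult])
  qed
qed

section \<open>Transfer of the permanence properties to smooth maps\<close>

lemma smooth_on_cong:
  "open S \<Longrightarrow> (\<And>x. x \<in> S \<Longrightarrow> f x = g x) \<Longrightarrow> smooth_on S f \<Longrightarrow> smooth_on S g"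
  unfolding smooth_on_def using Ck_on_cong by metis

lemma smooth_on_subset: "smooth_on S f \<Longrightarrow> T \<subseteq> S \<Longrightarrow> smooth_on T f"
  unfolding smooth_on_def using Ck_on_subset by metis

lemma smooth_on_const: "open S \<Longrightarrow> smooth_on S (\<lambda>x. c)"
  unfolding smooth_on_def using Ck_on_const by blast

lemma smooth_on_linear_comp:
  "open S \<Longrightarrow> bounded_linear h \<Longrightarrow> smooth_on S f \<Longrightarrow> smooth_on S (\<lambda>x. h (f x))"
  unfolding smooth_on_def using Ck_on_linear_comp by blast

lemma smooth_on_add:
  "open S \<Longrightarrow> smooth_on S f \<Longrightarrow> smooth_on S g \<Longrightarrow> smooth_on S (\<lambda>x. f x + g x)"
  unfolding smooth_on_def using Ck_on_add by blast

lemma smooth_on_minus: "open S \<Longrightarrow> smooth_on S f \<Longrightarrow> smooth_on S (\<lambda>x. - f x)"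
  using smooth_on_linear_comp[OF _ bounded_linear_minus[OF bounded_linear_ident]] .

lemma smooth_on_diff:
  "open S \<Longrightarrow> smooth_on S f \<Longrightarrow> smooth_on S g \<Longrightarrow> smooth_on S (\<lambda>x. f x - g x)"
  using smooth_on_add[OF _ _ smooth_on_minus] by fastforce

lemma smooth_on_scaleR:
  "open S \<Longrightarrow> smooth_on S f \<Longrightarrow> smooth_on S g \<Longrightarrow> smooth_on S (\<lambda>x. f x *\<^sub>R g x)"
  unfolding smooth_on_def using Ck_on_bilinear[OF _ bounded_bilinear_scaleR] by blast

lemma smooth_on_mult:
  fixes f g :: "'a::euclidean_space \<Rightarrow> real"
  shows "open S \<Longrightarrow> smooth_on S f \<Longrightarrow> smooth_on S g \<Longrightarrow> smooth_on S (\<lambda>x. f x * g x)"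
  using smooth_on_scaleR[of S f g] by simp

lemma smooth_on_inner:
  "open S \<Longrightarrow> smooth_on S f \<Longrightarrow> smooth_on S g \<Longrightarrow> smooth_on S (\<lambda>x. f x \<bullet> g x)"
  unfolding smooth_on_def using Ck_on_bilinear[OF _ bounded_bilinear_inner] by blast

lemma smooth_on_divide:
  fixes f g :: "'a::euclidean_space \<Rightarrow> real"
  shows "open S \<Longrightarrow> smooth_on S f \<Longrightarrow> smooth_on S g \<Longrightarrow> (\<And>x. x \<in> S \<Longrightarrow> g x \<noteq> 0) \<Longrightarrow>
    smooth_on S (\<lambda>x. f x / g x)"
  using smooth_on_mult[of S f "\<lambda>x. inverse (g x)"] Ck_on_inverse[of S g]
  unfolding smooth_on_def divide_inverse by blast

lemma smooth_on_sum:
  "open S \<Longrightarrow> (\<And>i. i \<in> I \<Longrightarrow> smooth_on S (f i)) \<Longrightarrow> smooth_on S (\<lambda>x. \<Sum>i\<in>I. f i x)"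
  unfolding smooth_on_def by (simp add: Ck_on_sum)

lemma smooth_on_prod:
  fixes f :: "'i \<Rightarrow> 'a::euclidean_space \<Rightarrow> real"
  shows "open S \<Longrightarrow> (\<And>i. i \<in> I \<Longrightarrow> smooth_on S (f i)) \<Longrightarrow> smooth_on S (\<lambda>x. \<Prod>i\<in>I. f i x)"
  by (induction I rule: infinite_finite_induct) (auto intro: smooth_on_const smooth_on_mult)

lemma smooth_on_compose:
  fixes f :: "'a::euclidean_space \<Rightarrow> 'b::euclidean_space"
  shows "open S \<Longrightarrow> open T \<Longrightarrow> f ` S \<subseteq> T \<Longrightarrow> smooth_on T g \<Longrightarrow> smooth_on S f \<Longrightarrow>
    smooth_on S (\<lambda>x. g (f x))"
  unfolding smooth_on_def using Ck_on_compose by blast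

lemma smooth_on_vec_nth: "open S \<Longrightarrow> smooth_on S f \<Longrightarrow> smooth_on S (\<lambda>x. f x $ i)"
  using smooth_on_linear_comp[OF _ bounded_linear_vec_nth] .

lemma smooth_on_vec:
  fixes f :: "'a::euclidean_space \<Rightarrow> real^'n::finite"
  assumes "open S" "\<And>i. smooth_on S (\<lambda>x. f x $ i)"
  shows "smooth_on S f"
proof -
  have "smooth_on S (\<lambda>x. \<Sum>i\<in>UNIV. (f x $ i) *\<^sub>R (axis i 1 :: real^'n))"
    using assms by (intro smooth_on_sum smooth_on_scaleR smooth_on_const)
  moreover have "(\<lambda>x. \<Sum>i\<in>UNIV. (f x $ i) *\<^sub>R (axis i 1 :: real^'n)) = f"
    using basis_expansion[of "f x" for x] by (simp add: scalar_mult_eq_scaleR)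
  ultimately show ?thesis by simp
qed

lemma smooth_on_det:
  fixes M :: "'a::euclidean_space \<Rightarrow> real^'n::finite^'n"
  assumes "open S" "\<And>i j. smooth_on S (\<lambda>x. M x $ i $ j)"
  shows "smooth_on S (\<lambda>x. det (M x))"
  unfolding det_def using assms
  by (intro smooth_on_sum smooth_on_mult smooth_on_prod smooth_on_const)

lemma smooth_on_has_derivative:
  "smooth_on S f \<Longrightarrow> x \<in> S \<Longrightarrow> (f has_derivative frechet_derivative f (at x)) (at x)"
  unfolding smooth_on_def using Ck_on_has_derivative by blast

lemma smooth_on_frechet_derivative:
  "smooth_on S f \<Longrightarrow> smooth_on S (\<lambda>x. frechet_derivative f (at x) v)"
  unfolding smooth_on_def using Ck_on.simps(2) by blast

lemma smooth_on_continuous: "smooth_on S f \<Longrightarrow> continuous_on S f"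
  unfolding smooth_on_def using Ck_on.simps(1) by blast

text \<open>The direction varies with the point, so it is expanded over \<open>Basis\<close> and
  only fixed directions remain to be differentiated along. This handles vector fields under a change
  of chart.\<close>

lemma smooth_on_frechet_derivative_apply:
  fixes f :: "'a::euclidean_space \<Rightarrow> 'b::real_normed_vector" and w :: "'a \<Rightarrow> 'a"
  assumes "open S" "smooth_on S f" "smooth_on S w"
  shows "smooth_on S (\<lambda>x. frechet_derivative f (at x) (w x))"
proof -
  have "smooth_on S (\<lambda>x. \<Sum>b\<in>Basis. (w x \<bullet> b) *\<^sub>R frechet_derivative f (at x) b)"
    using assms by (intro smooth_on_sum smooth_on_scaleR smooth_on_inner smooth_on_const
        smooth_on_frechet_derivative)
  moreover have "(\<Sum>b\<in>Basis. (w x \<bullet> b) *\<^sub>R frechet_derivative f (at x) b) =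
      frechet_derivative f (at x) (w x)" if "x \<in> S" for x
  proof -
    have "linear (frechet_derivative f (at x))"
      using smooth_on_has_derivative[OF assms(2) that] has_derivative_linear by blast
    then have "frechet_derivative f (at x) (\<Sum>b\<in>Basis. (w x \<bullet> b) *\<^sub>R b) =
        (\<Sum>b\<in>Basis. (w x \<bullet> b) *\<^sub>R frechet_derivative f (at x) b)"
      by (simp add: linear_sum linear_cmul)
    then show ?thesis by (simp add: euclidean_representation)
  qed
  ultimately show ?thesis by (rule smooth_on_cong[OF assms(1), rotated])
qed

section \<open>Symmetric matrices\<close>

definition replace_row :: "'a^'n^'m \<Rightarrow> 'm \<Rightarrow> 'a^'n \<Rightarrow> 'a^'n^'m" where
  "replace_row G j v = (\<chi> i. if i = j then v else G $ i)"

lemma det_replace_row_sum: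
  fixes G :: "real^'n^'n"
  shows "det (replace_row G j (\<Sum>k\<in>I. c k *\<^sub>R v k)) = (\<Sum>k\<in>I. c k * det (replace_row G j (v k)))"
proof (induction I rule: infinite_finite_induct)
  case (insert k I)
  then show ?case
    using det_row_add[of j "\<lambda>_. c k *\<^sub>R v k" "\<lambda>_. \<Sum>k\<in>I. c k *\<^sub>R v k" "\<lambda>i. G $ i"]
      det_row_mul[of j "c k" "\<lambda>_. v k" "\<lambda>i. G $ i"]
    unfolding replace_row_def scalar_mult_eq_scaleR sum.insert[OF insert.hyps] by simp
qed (use det_row_0[of j "\<lambda>i. G $ i"] in \<open>auto simp: replace_row_def\<close>)

text \<open>The \<open>(k, j)\<close> entry of the adjugate is \<open>det G\<close> with row \<open>j\<close> replaced by the \<open>k\<close>-th unit vector.\<close>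

definition adjugate_mv :: "real^'n^'n \<Rightarrow> real^'n \<Rightarrow> real^'n" where
  "adjugate_mv G b = (\<chi> k. \<Sum>j\<in>UNIV. b $ j * det (replace_row G j (axis k 1)))"

text \<open>Cramer's rule. Pairing row \<open>i\<close> of \<open>G\<close> with column
  \<open>j\<close> of the adjugate gives, by linearity in row \<open>j\<close>, the determinant of
  \<open>G\<close> with row \<open>j\<close> replaced by row \<open>i\<close>; for distinct
  \<open>i\<close> and \<open>j\<close> this has two equal rows.\<close>

lemma matrix_adjugate_mv: "G *v adjugate_mv G b = det G *\<^sub>R b" for G :: "real^'n^'n"
proof (rule vec_eq_iff[THEN iffD2, rule_format])
  fix i
  have row: "(\<Sum>k\<in>UNIV. G $ i $ k * det (replace_row G j (axis k 1))) = (if i = j then det G else 0)" for j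
  proof -
    have "(\<Sum>k\<in>UNIV. G $ i $ k * det (replace_row G j (axis k 1))) = det (replace_row G j (G $ i))"
      using det_replace_row_sum[of G j "\<lambda>k. G $ i $ k" "\<lambda>k. axis k 1" UNIV]
      by (simp add: basis_expansion flip: scalar_mult_eq_scaleR)
    moreover have "det (replace_row G j (G $ i)) = 0" if "i \<noteq> j"
      using that by (intro det_identical_rows[OF that]) (simp add: row_def replace_row_def)
    moreover have "replace_row G i (G $ i) = G"
      by (simp add: replace_row_def vec_eq_iff)
    ultimately show ?thesis by auto
  qed
  have "(G *v adjugate_mv G b) $ i = (\<Sum>j\<in>UNIV. \<Sum>k\<in>UNIV. G $ i $ k * (b $ j * det (replace_row G j (axis k 1))))"
    unfolding matrix_vector_mult_def adjugate_mv_def by (simp add: sum_distrib_left, rule sum.swap)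
  also have "\<dots> = (\<Sum>j\<in>UNIV. b $ j * (\<Sum>k\<in>UNIV. G $ i $ k * det (replace_row G j (axis k 1))))"
    by (simp add: sum_distrib_left mult.left_commute)
  also have "\<dots> = (det G *\<^sub>R b) $ i"
    by (simp add: row if_distrib cong: if_cong)
  finally show "(G *v adjugate_mv G b) $ i = (det G *\<^sub>R b) $ i" .
qed

text \<open>A nonzero adjugate has a nonzero entry, so replacing a suitable row of \<open>G\<close>
  by a unit vector gives an invertible matrix. Hence the kernel is at most one-dimensional, and
  \<open>G *v adjugate_mv G b = 0\<close> exhibits a vector spanning it.\<close>

lemma adjugate_mv_spans_kernel:
  fixes G :: "real^'n^'n"
  assumes V: "adjugate_mv G b \<noteq> 0" and G: "det G = 0" "G *v w = 0"
  obtains r where "w = r *\<^sub>R adjugate_mv G b"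
proof -
  let ?V = "adjugate_mv G b"
  obtain k where "(\<Sum>j\<in>UNIV. b $ j * det (replace_row G j (axis k 1))) \<noteq> 0"
    using V by (auto simp: adjugate_mv_def vec_eq_iff)
  then obtain j where j: "det (replace_row G j (axis k 1)) \<noteq> 0"
    by (metis (no_types, lifting) mult_zero_right sum.neutral)
  \<comment> \<open>A kernel vector with vanishing \<open>k\<close>-th entry is also killed by the
    new row \<open>axis k 1\<close>, hence by an invertible matrix.\<close>
  have k: "w = 0" if w: "G *v w = 0" "w $ k = 0" for w
  proof -
    have "replace_row G j (axis k 1) *v w = 0"
    proof (rule vec_eq_iff[THEN iffD2, rule_format])
      fix i
      have "(G *v w) $ i = 0" using w by simp
      then show "(replace_row G j (axis k 1) *v w) $ i = 0 $ i"
        using w(2) by (cases "i = j")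
          (simp_all add: matrix_vector_mult_def replace_row_def axis_def if_distribR if_distrib[of "\<lambda>x. x * _"] cong: if_cong)
    qed
    moreover obtain B where "B ** replace_row G j (axis k 1) = mat 1"
      using j unfolding invertible_det_nz[symmetric] invertible_def by auto
    ultimately show ?thesis
      by (metis matrix_vector_mul_assoc matrix_vector_mul_lid matrix_vector_mult_0_right)
  qed
  have GV: "G *v ?V = 0" using matrix_adjugate_mv[of G b] G(1) by simp
  have Vk: "?V $ k \<noteq> 0" using k[OF GV] V by blast
  have "w - (w $ k / ?V $ k) *\<^sub>R ?V = 0"
  proof (rule k)
    show "G *v (w - (w $ k / ?V $ k) *\<^sub>R ?V) = 0"
      by (simp add: matrix_vector_mult_diff_distrib matrix_vector_mult_scaleR G(2) GV)
    show "(w - (w $ k / ?V $ k) *\<^sub>R ?V) $ k = 0"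
      using Vk by simp
  qed
  then show thesis using that[of "w $ k / ?V $ k"] by simp
qed

text \<open>The perturbation is switched on one row at a time, over growing index sets
  \<open>S\<close>. By linearity in the new row \<open>k\<close>, each step adds
  \<open>u $ k\<close> times the determinant in which that row is \<open>v\<close>.\<close>

lemma det_eye_plus_rank_one:
  fixes u v :: "real^'n"
  shows "det (\<chi> i. axis i 1 + u $ i *\<^sub>R v) = 1 + u \<bullet> v"
proof -
  have "det (\<chi> i. if i \<in> S then axis i 1 + u $ i *\<^sub>R v else axis i 1) = 1 + (\<Sum>i\<in>S. u $ i * v $ i)"
    if "finite S" for S
    using that
  proof (induction S)
    case empty
    have "(\<chi> i. axis i 1) = (mat 1 :: real^'n^'n)" by (simp add: mat_def axis_def vec_eq_iff)
    then show ?case by simp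
  next
    case (insert k S)
    define C where "C = (\<lambda>i. if i \<in> S then axis i 1 + u $ i *\<^sub>R v else axis i 1)"
    define B where "B = (\<chi> i. C i)"
    have C: "(\<chi> i. if i = k then axis k 1 else C i) = B"
      unfolding B_def C_def using insert.hyps by (auto simp: vec_eq_iff)
    \<comment> \<open>Once row \<open>k\<close> equals \<open>v\<close>, the multiples of
      \<open>v\<close> in the other rows are removed by row operations. What remains is the identity
      with row \<open>k\<close> replaced by \<open>v\<close>, of determinant
      \<open>v $ k\<close>.\<close>
    have del: "det (\<chi> i. if i = k then v else if i \<in> T then axis i 1 + u $ i *\<^sub>R v else axis i 1) = v $ k"
      if "finite T" "k \<notin> T" for T
      using that
    proof (induction T)
      case empty
      have "(\<chi> i. if i = k then (v::real^'n) else axis i 1) = replace_row (mat 1) k v"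
        by (simp add: replace_row_def mat_def axis_def vec_eq_iff)
      moreover have "det (replace_row (mat 1) k v) = (\<Sum>l\<in>UNIV. v $ l * det (replace_row (mat 1) k (axis l 1)))"
        using det_replace_row_sum[of "mat 1" k "\<lambda>l. v $ l" "\<lambda>l. axis l 1" UNIV]
        by (simp add: basis_expansion flip: scalar_mult_eq_scaleR)
      moreover have "det (replace_row (mat 1 :: real^'n^'n) k (axis l 1)) = (if l = k then 1 else 0)" for l
      proof (cases "l = k")
        case True
        then have "replace_row (mat 1 :: real^'n^'n) k (axis l 1) = mat 1"
          by (simp add: replace_row_def mat_def axis_def vec_eq_iff)
        then show ?thesis using True by simp
      next
        case False
        then have "det (replace_row (mat 1 :: real^'n^'n) k (axis l 1)) = 0"
          by (intro det_identical_rows[OF False])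
            (simp add: row_def replace_row_def mat_def axis_def vec_eq_iff)
        then show ?thesis using False by simp
      qed
      ultimately show ?case by (simp add: if_distrib cong: if_cong)
    next
      case (insert m T)
      define Z where "Z = (\<chi> i. if i = k then v else if i \<in> T then axis i 1 + u $ i *\<^sub>R v else axis i 1)"
      have "(\<chi> i. if i = k then v else if i \<in> insert m T then axis i 1 + u $ i *\<^sub>R v else axis i 1) =
          (\<chi> i. if i = m then row m Z + u $ m *s row k Z else row i Z)"
        using insert by (auto simp: Z_def row_def vec_eq_iff)
      moreover have "m \<noteq> k" using insert by auto
      ultimately show ?case
        using det_row_operation[of m k Z "u $ m"] insert unfolding Z_def by simp
    qed
    have "(\<chi> i. if i \<in> insert k S then axis i 1 + u $ i *\<^sub>R v else axis i 1) =
        (\<chi> i. if i = k then axis k 1 + u $ k *s v else C i)"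
      unfolding C_def by (simp add: vec_eq_iff)
    then have "det (\<chi> i. if i \<in> insert k S then axis i 1 + u $ i *\<^sub>R v else axis i 1) =
        det B + u $ k * det (\<chi> i. if i = k then v else C i)"
      using det_row_add[of k "\<lambda>_. axis k 1" "\<lambda>_. u $ k *s v" C] det_row_mul[of k "u $ k" "\<lambda>_. v" C] C
      by simp
    also have "\<dots> = 1 + (\<Sum>i\<in>insert k S. u $ i * v $ i)"
      using insert del[of S] unfolding B_def C_def by simp
    finally show ?case .
  qed
  from this[of UNIV] show ?thesis by (simp add: inner_vec_def)
qed

lemma symmetric_matrix_inner: "transpose G = G \<Longrightarrow> x \<bullet> (G *v y) = y \<bullet> (G *v x)" for G :: "real^'n^'n"
  by (metis dot_lmul_matrix inner_commute transpose_matrix_vector)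

text \<open>The perturbed matrix is \<open>G\<close> times the identity plus the rank one matrix
  with rows \<open>f * u $ i\<close> times \<open>G *v u\<close>, so the product rule for
  determinants applies.\<close>

lemma det_add_flat:
  fixes G :: "real^'n^'n"
  assumes "transpose G = G"
  shows "det (\<chi> i j. G $ i $ j + f * ((G *v u) $ i * (G *v u) $ j)) = det G * (1 + f * (u \<bullet> (G *v u)))"
proof -
  have "(\<chi> i j. G $ i $ j + f * ((G *v u) $ i * (G *v u) $ j)) =
      G ** (\<chi> i. axis i 1 + (f *\<^sub>R u) $ i *\<^sub>R (G *v u))"
  proof (simp only: vec_eq_iff, intro allI)
    fix i j
    define w where "w = G *v u"
    have "(G ** (\<chi> i. axis i 1 + (f *\<^sub>R u) $ i *\<^sub>R w)) $ i $ j =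
        (\<Sum>k\<in>UNIV. (if k = j then G $ i $ k else 0) + f * w $ j * (G $ i $ k * u $ k))"
      unfolding matrix_matrix_mult_def by (auto simp: axis_def algebra_simps intro!: sum.cong)
    also have "\<dots> = G $ i $ j + f * (w $ i * w $ j)"
    proof -
      have "w $ i = (\<Sum>k\<in>UNIV. G $ i $ k * u $ k)" by (simp add: w_def matrix_vector_mult_def)
      then show ?thesis by (simp add: sum.distrib flip: sum_distrib_left)
    qed
    finally show "(\<chi> i j. G $ i $ j + f * ((G *v u) $ i * (G *v u) $ j)) $ i $ j =
        (G ** (\<chi> i. axis i 1 + (f *\<^sub>R u) $ i *\<^sub>R (G *v u))) $ i $ j"
      by (simp add: w_def)
  qed
  then show ?thesis by (simp only: det_mul det_eye_plus_rank_one) simp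
qed

lemma add_rank_one_mult:
  fixes G :: "real^'n^'n"
  shows "(\<chi> i j. G $ i $ j + r * (w $ i * w $ j)) *v x = G *v x + (r * (x \<bullet> w)) *\<^sub>R w"
  by (simp add: vec_eq_iff matrix_vector_mult_def inner_vec_def sum_distrib_left algebra_simps
      flip: sum.distrib)

section \<open>Positive definite and Lorentzian matrices\<close>

definition pos_def :: "real^'n^'n \<Rightarrow> bool" where
  "pos_def G \<longleftrightarrow> transpose G = G \<and> (\<forall>w. w \<noteq> 0 \<longrightarrow> w \<bullet> (G *v w) > 0)"

text \<open>Gram-Schmidt for the inner product defined by \<open>G\<close>, started at
  \<open>u\<close> in position \<open>k\<close> and extended through finite index sets.\<close>

lemma pos_def_orthonormal_basis:
  fixes G :: "real^'n^'n" and k :: 'n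
  assumes G: "pos_def G" and u: "u \<bullet> (G *v u) = 1"
  obtains e where "e k = u" "\<And>i j. e i \<bullet> (G *v e j) = (if i = j then 1 else 0)"
proof -
  have sym: "x \<bullet> (G *v y) = y \<bullet> (G *v x)" for x y
    using G symmetric_matrix_inner unfolding pos_def_def by blast
  have "\<exists>e. e k = u \<and> (\<forall>i\<in>insert k S. \<forall>j\<in>insert k S. e i \<bullet> (G *v e j) = (if i = j then 1 else 0))"
    if "finite S" for S
    using that
  proof (induction S)
    case empty
    show ?case using u by auto
  next
    case (insert m S)
    then obtain e where e: "e k = u"
      "\<And>i j. i \<in> insert k S \<Longrightarrow> j \<in> insert k S \<Longrightarrow> e i \<bullet> (G *v e j) = (if i = j then 1 else 0)"
      by blast
    show ?case
    proof (cases "m = k")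
      case True
      then show ?thesis using e by (intro exI[of _ e]) simp
    next
      case False
      let ?S = "insert k S"
      \<comment> \<open>Fewer than \<open>CARD('n)\<close> vectors do not span, so some
        \<open>x\<close> lies outside their span; subtracting its projection and normalising gives
        the next basis vector.\<close>
      have m: "m \<notin> ?S" using insert False by auto
      then have "?S \<subset> UNIV" by auto
      then have "card ?S < CARD('n)"
        by (rule psubset_card_mono[OF finite])
      then have "dim (span (e ` ?S)) < DIM(real^'n)"
        using dim_le_card'[of "e ` ?S"] card_image_le[of ?S e] insert.hyps(1)
        by (simp add: dim_span)
      then have "span (e ` ?S) \<noteq> UNIV" by (metis dim_UNIV nat_neq_iff)
      then obtain x where x: "x \<notin> span (e ` ?S)" by auto
      define y where "y = x - (\<Sum>i\<in>?S. (e i \<bullet> (G *v x)) *\<^sub>R e i)"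
      have "(\<Sum>i\<in>?S. (e i \<bullet> (G *v x)) *\<^sub>R e i) \<in> span (e ` ?S)"
        by (intro span_sum span_scale span_base) auto
      then have "y \<noteq> 0" using x unfolding y_def by auto
      then have pos: "y \<bullet> (G *v y) > 0" using G unfolding pos_def_def by auto
      have orth: "e j \<bullet> (G *v y) = 0" if j: "j \<in> ?S" for j
      proof -
        have "e j \<bullet> (G *v y) = e j \<bullet> (G *v x) - (\<Sum>i\<in>?S. (e i \<bullet> (G *v x)) * (e j \<bullet> (G *v e i)))"
          unfolding y_def
          by (simp only: matrix_vector_mult_diff_distrib inner_diff_right linear_sum[OF matrix_vector_mul_linear]
              inner_sum_right matrix_vector_mult_scaleR inner_scaleR_right)
        also have "(\<Sum>i\<in>?S. (e i \<bullet> (G *v x)) * (e j \<bullet> (G *v e i))) = (\<Sum>i\<in>?S. if j = i then e i \<bullet> (G *v x) else 0)"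
          using e(2)[OF j] by (intro sum.cong) auto
        also have "\<dots> = e j \<bullet> (G *v x)"
          using j insert.hyps(1) by (subst sum.delta') auto
        finally show ?thesis by simp
      qed
      define z where "z = (1 / sqrt (y \<bullet> (G *v y))) *\<^sub>R y"
      have z: "z \<bullet> (G *v z) = 1"
        using pos unfolding z_def by (simp add: matrix_vector_mult_scaleR)
      have oz: "e j \<bullet> (G *v z) = 0" "z \<bullet> (G *v e j) = 0" if j: "j \<in> ?S" for j
        using orth[OF j] sym[of z "e j"] unfolding z_def by (simp_all add: matrix_vector_mult_scaleR)
      have "\<forall>i\<in>insert k (insert m S). \<forall>j\<in>insert k (insert m S).
          (e(m := z)) i \<bullet> (G *v (e(m := z)) j) = (if i = j then 1 else 0)"
        using e(2) m z oz by (auto simp: fun_upd_def)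
      then show ?thesis using e(1) False by (intro exI[of _ "e(m := z)"]) auto
    qed
  qed
  from this[of UNIV] show thesis using that by auto
qed

text \<open>With the vectors \<open>e i\<close> as rows of \<open>E\<close>, the Gram matrix is
  \<open>E G E^T\<close>. Its determinant relates the sign of \<open>det G\<close> to the product of
  the \<open>d i\<close>.\<close>

lemma gram_matrix:
  fixes G :: "real^'n^'n"
  assumes "\<And>i j. e i \<bullet> (G *v e j) = (if i = j then d i else 0)"
  shows "(det (\<chi> i. e i))\<^sup>2 * det G = prod d UNIV"
proof -
  have "(\<chi> i. e i) ** G ** transpose (\<chi> i. e i) = (\<chi> i j. e i \<bullet> (G *v e j))"
    by (simp add: vec_eq_iff matrix_matrix_mult_def matrix_vector_mult_def inner_vec_def
        transpose_def sum_distrib_left sum_distrib_right mult_ac)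
       (intro allI sum.swap)
  also have "\<dots> = (\<chi> i j. if i = j then d i else 0)"
    using assms by simp
  finally have "det ((\<chi> i. e i) ** G ** transpose (\<chi> i. e i)) = prod d UNIV"
    by (simp add: det_diagonal)
  then show ?thesis by (simp add: det_mul det_transpose power2_eq_square mult_ac)
qed

lemma pos_def_det_pos:
  fixes G :: "real^'n^'n"
  assumes "pos_def G"
  shows "det G > 0"
proof -
  \<comment> \<open>Any nonzero vector will do; normalised, it is the first vector of an orthonormal
    basis.\<close>
  define x :: "real^'n" where "x = axis undefined 1"
  have "x \<noteq> 0" by (simp add: x_def axis_eq_0_iff)
  then have pos: "x \<bullet> (G *v x) > 0" using assms unfolding pos_def_def by auto
  then have "((1 / sqrt (x \<bullet> (G *v x))) *\<^sub>R x) \<bullet> (G *v ((1 / sqrt (x \<bullet> (G *v x))) *\<^sub>R x)) = 1"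
    by (simp add: matrix_vector_mult_scaleR)
  from pos_def_orthonormal_basis[OF assms this] obtain e :: "'n \<Rightarrow> real^'n"
    where "\<And>i j. e i \<bullet> (G *v e j) = (if i = j then 1 else 0)" by metis
  from gram_matrix[of e G, OF this] have "(det (\<chi> i. e i))\<^sup>2 * det G = 1" by simp
  then show ?thesis by (metis zero_less_mult_pos zero_le_power2 zero_less_one order_le_less mult_zero_left zero_neq_one)
qed

text \<open>Matrix counterpart of the frame in \<open>lorentzian_at\<close>; \<open>k\<close> is the
  index of the timelike vector.\<close>

definition lorentz_basis :: "real^'n^'n \<Rightarrow> ('n \<Rightarrow> real^'n) \<Rightarrow> 'n \<Rightarrow> bool" where
  "lorentz_basis G e k \<longleftrightarrow>
     (\<forall>i j. e i \<bullet> (G *v e j) = (if i \<noteq> j then 0 else if i = k then -1 else 1))"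

lemma lorentz_basis_det:
  assumes "lorentz_basis G e k"
  shows "det G < 0" "det (\<chi> i. e i) \<noteq> 0"
proof -
  have "(det (\<chi> i. e i))\<^sup>2 * det G = prod (\<lambda>i. if i = k then -1 else 1) UNIV"
    using assms unfolding lorentz_basis_def by (intro gram_matrix) auto
  then have "(det (\<chi> i. e i))\<^sup>2 * det G = -1"
    by simp
  then show "det G < 0" "det (\<chi> i. e i) \<noteq> 0"
    by (smt (verit) mult_nonneg_nonneg zero_le_power2, auto)
qed

lemma lorentz_basis_expansion:
  fixes G :: "real^'n^'n"
  assumes "lorentz_basis G e k"
  obtains c where "x = (\<Sum>i\<in>UNIV. c i *\<^sub>R e i)"
proof -
  have "invertible (transpose (\<chi> i. e i))"
    using lorentz_basis_det(2)[OF assms] by (simp add: invertible_det_nz det_transpose)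
  then obtain B where "transpose (\<chi> i. e i) ** B = mat 1" unfolding invertible_def by auto
  then have "transpose (\<chi> i. e i) *v (B *v x) = x"
    by (simp add: matrix_vector_mul_assoc)
  then have "x = (\<Sum>i\<in>UNIV. (B *v x) $ i *\<^sub>R e i)"
    unfolding matrix_vector_mult_def[of "transpose _"] by (simp add: vec_eq_iff transpose_def mult.commute)
  then show thesis using that by blast
qed

text \<open>Pairing with \<open>e i\<close> reads off the \<open>i\<close>-th coefficient up to
  sign. Orthogonality to \<open>e k\<close> removes the only coefficient whose square enters
  negatively.\<close>

lemma lorentz_basis_pos:
  fixes G :: "real^'n^'n"
  assumes "lorentz_basis G e k" "e k \<bullet> (G *v w) = 0" "w \<noteq> 0"
  shows "w \<bullet> (G *v w) > 0"
proof -
  obtain c where c: "w = (\<Sum>i\<in>UNIV. c i *\<^sub>R e i)" using lorentz_basis_expansion[OF assms(1)] .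
  have ew: "e i \<bullet> (G *v w) = (if i = k then - c k else c i)" for i
  proof -
    have "e i \<bullet> (G *v w) = (\<Sum>j\<in>UNIV. c j * (e i \<bullet> (G *v e j)))"
      unfolding c by (simp only: linear_sum[OF matrix_vector_mul_linear] inner_sum_right
          matrix_vector_mult_scaleR inner_scaleR_right)
    also have "\<dots> = (\<Sum>j\<in>UNIV. if i = j then c i * (if i = k then -1 else 1) else 0)"
      using assms(1) unfolding lorentz_basis_def by (intro sum.cong) auto
    finally show ?thesis by simp
  qed
  have ck: "c k = 0" using ew[of k] assms(2) by simp
  have "w \<bullet> (G *v w) = (\<Sum>i\<in>UNIV. c i * (e i \<bullet> (G *v w)))"
    by (subst (1) c) (simp add: inner_sum_left)
  also have "\<dots> = (\<Sum>i\<in>UNIV. (c i)\<^sup>2)"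
    using ck by (intro sum.cong) (auto simp: ew power2_eq_square)
  finally have eq: "w \<bullet> (G *v w) = (\<Sum>i\<in>UNIV. (c i)\<^sup>2)" .
  obtain i where "c i \<noteq> 0" using assms(3) c by (metis (no_types, lifting) scale_zero_left sum.neutral)
  then have "(\<Sum>i\<in>UNIV. (c i)\<^sup>2) > 0"
    by (intro sum_pos2[of _ i]) auto
  then show ?thesis using eq by simp
qed

text \<open>Adding \<open>2 \<omega> \<otimes> \<omega>\<close> with
  \<open>\<omega> = G *v u\<close> reverses the sign of the form on \<open>u\<close> and leaves it
  unchanged on the \<open>G\<close>-orthogonal complement. The result \<open>H\<close> is positive
  definite, and an \<open>H\<close>-orthonormal basis starting at \<open>u\<close> is
  pseudo-orthonormal for \<open>G\<close>.\<close>

lemma lorentz_basis_exists: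
  fixes G :: "real^'n^'n"
  assumes sym: "transpose G = G" and u: "u \<bullet> (G *v u) = -1"
    and pos: "\<And>w. u \<bullet> (G *v w) = 0 \<Longrightarrow> w \<noteq> 0 \<Longrightarrow> w \<bullet> (G *v w) > 0"
  obtains e where "lorentz_basis G e k"
proof -
  define \<omega> where "\<omega> = G *v u"
  define H where "H = (\<chi> i j. G $ i $ j + 2 * (\<omega> $ i * \<omega> $ j))"
  have H: "x \<bullet> (H *v y) = x \<bullet> (G *v y) + 2 * (x \<bullet> \<omega>) * (y \<bullet> \<omega>)" for x y
  proof -
    have "H *v y = G *v y + (2 * (y \<bullet> \<omega>)) *\<^sub>R \<omega>"
      unfolding H_def by (rule add_rank_one_mult)
    then show ?thesis by (simp add: inner_add_right)
  qed
  have symG: "x \<bullet> (G *v y) = y \<bullet> (G *v x)" for x y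
    using symmetric_matrix_inner[OF sym] .
  have "transpose H = H"
    using sym by (simp add: H_def transpose_def vec_eq_iff mult.commute)
  moreover have "w \<bullet> (H *v w) > 0" if "w \<noteq> 0" for w
  proof -
    define a where "a = w \<bullet> \<omega>"
    \<comment> \<open>The component of \<open>w\<close> in the complement of \<open>u\<close>; the
      sign is plus because \<open>u\<close> has square -1.\<close>
    define z where "z = w + a *\<^sub>R u"
    have uz: "u \<bullet> (G *v z) = 0"
      using u symG[of u w] unfolding z_def a_def \<omega>_def
      by (simp add: matrix_vector_right_distrib matrix_vector_mult_scaleR inner_add_right)
    have w: "w = z - a *\<^sub>R u" unfolding z_def by simp
    have "w \<bullet> (G *v w) = z \<bullet> (G *v z) - a\<^sup>2"
      unfolding w using uz u symG[of z u]
      by (simp add: matrix_vector_mult_diff_distrib matrix_vector_mult_scaleR inner_diff_left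
          inner_diff_right power2_eq_square)
    then have eq: "w \<bullet> (H *v w) = z \<bullet> (G *v z) + a\<^sup>2"
      unfolding H a_def[symmetric] by (simp add: power2_eq_square)
    show ?thesis
    proof (cases "z = 0")
      case True
      then have "a \<noteq> 0" using that w by auto
      then show ?thesis using eq True by simp
    next
      case False
      then show ?thesis using eq pos[OF uz False] by (simp add: add_pos_nonneg)
    qed
  qed
  ultimately have "pos_def H" unfolding pos_def_def by auto
  moreover have "u \<bullet> (H *v u) = 1" using u unfolding H by (simp add: \<omega>_def)
  ultimately obtain e where e: "e k = u" "\<And>i j. e i \<bullet> (H *v e j) = (if i = j then 1 else 0)"
    using pos_def_orthonormal_basis by metis
  \<comment> \<open>As \<open>u \<bullet> \<omega> = -1\<close>, pairing \<open>e i\<close> with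
    \<open>u\<close> under \<open>H\<close> gives \<open>- (e i \<bullet> \<omega>)\<close>, which
    orthonormality evaluates.\<close>
  have e\<omega>: "e i \<bullet> \<omega> = (if i = k then -1 else 0)" for i
    using e(2)[of i k] u unfolding e(1) H \<omega>_def[symmetric] by (simp add: e(1) \<omega>_def split: if_splits)
  have "lorentz_basis G e k"
    unfolding lorentz_basis_def
  proof (intro allI)
    fix i j
    show "e i \<bullet> (G *v e j) = (if i \<noteq> j then 0 else if i = k then -1 else 1)"
      using e(2)[of i j] unfolding H e\<omega> by (auto split: if_splits)
  qed
  then show thesis by (rule that)
qed

text \<open>If \<open>z = G *v w\<close> were nonzero, a small step from \<open>w\<close> in the
  direction \<open>-z\<close> would make the form negative, its first order term being
  \<open>-2 t (z \<bullet> z)\<close>.\<close>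

lemma psd_kernel:
  fixes G :: "real^'n^'n"
  assumes sym: "transpose G = G" and psd: "\<And>w. w \<bullet> (G *v w) \<ge> 0" and w: "w \<bullet> (G *v w) = 0"
  shows "G *v w = 0"
proof (rule ccontr)
  define z where "z = G *v w"
  define c where "c = z \<bullet> (G *v z)"
  assume "G *v w \<noteq> 0"
  then have zz: "z \<bullet> z > 0" unfolding z_def by simp
  have c: "c \<ge> 0" using psd unfolding c_def .
  \<comment> \<open>Small enough that the second order term cannot compensate the first;
    \<open>c + 1\<close> avoids division by zero when \<open>c = 0\<close>.\<close>
  define t where "t = z \<bullet> z / (c + 1)"
  have t: "t > 0" "t * c < 2 * (z \<bullet> z)"
    using zz c unfolding t_def by (auto simp: field_simps intro!: add_nonneg_pos)
  have "0 \<le> (w - t *\<^sub>R z) \<bullet> (G *v (w - t *\<^sub>R z))" by (rule psd)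
  also have "\<dots> = t * (t * c - 2 * (z \<bullet> z))"
    using w symmetric_matrix_inner[OF sym, of w z] unfolding c_def
    by (simp add: matrix_vector_mult_diff_distrib matrix_vector_mult_scaleR inner_diff_left
          inner_diff_right algebra_simps flip: z_def)
  also have "\<dots> < 0" using t by (simp add: mult_pos_neg)
  finally show False by simp
qed

text \<open>The unit sphere of the hyperplane is compact, so the limiting form has a positive
  minimum \<open>m\<close> there. Once the entries differ by less than \<open>m\<close> in total,
  positivity survives on unit vectors and, by scaling, on all nonzero ones.\<close>

lemma eventually_pos_on_hyperplane:
  fixes G :: "'a::topological_space \<Rightarrow> real^'n^'n"
  assumes cont: "\<And>i j. ((\<lambda>x. G x $ i $ j) \<longlongrightarrow> G0 $ i $ j) F"
    and pos: "\<And>w. b \<bullet> w = 0 \<Longrightarrow> w \<noteq> 0 \<Longrightarrow> w \<bullet> (G0 *v w) > 0"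
  shows "\<forall>\<^sub>F x in F. \<forall>w. b \<bullet> w = 0 \<longrightarrow> w \<noteq> 0 \<longrightarrow> w \<bullet> (G x *v w) > 0"
proof -
  define K where "K = sphere 0 1 \<inter> {w. b \<bullet> w = 0}"
  have K: "compact K" unfolding K_def
    by (intro compact_Int_closed compact_sphere closed_hyperplane)
  obtain m where m: "m > 0" "\<And>w. w \<in> K \<Longrightarrow> m \<le> w \<bullet> (G0 *v w)"
  proof (cases "K = {}")
    case False
    have "continuous_on K (\<lambda>w. w \<bullet> (G0 *v w))"
      by (intro continuous_intros linear_continuous_on) (simp add: matrix_vector_mul_bounded_linear)
    from continuous_attains_inf[OF K False this] obtain v
      where "v \<in> K" "\<And>w. w \<in> K \<Longrightarrow> v \<bullet> (G0 *v v) \<le> w \<bullet> (G0 *v w)" by blast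
    moreover from \<open>v \<in> K\<close> have "v \<bullet> (G0 *v v) > 0" by (intro pos) (auto simp: K_def)
    ultimately show ?thesis using that by blast
  \<comment> \<open>If the hyperplane contains only 0, its unit sphere \<open>K\<close> is empty and
    any positive \<open>m\<close> serves.\<close>
  qed (use that[of 1] in auto)
  define s where "s = (\<lambda>x. \<Sum>i\<in>UNIV. \<Sum>j\<in>UNIV. \<bar>G x $ i $ j - G0 $ i $ j\<bar>)"
  have "(s \<longlongrightarrow> (\<Sum>i\<in>UNIV. \<Sum>j\<in>UNIV. \<bar>G0 $ i $ j - G0 $ i $ j\<bar>)) F"
    unfolding s_def by (intro tendsto_intros cont)
  then have "(s \<longlongrightarrow> 0) F" by simp
  then have "\<forall>\<^sub>F x in F. s x < m" using m(1) by (rule order_tendstoD)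
  then show ?thesis
  proof eventually_elim
    case (elim x)
    have unit: "v \<bullet> (G x *v v) > 0" if v: "v \<in> K" for v
    proof -
      have n: "\<bar>v $ i\<bar> \<le> 1" for i
        using component_le_norm_cart[of v i] v unfolding K_def by simp
      have "v \<bullet> (G0 *v v) - v \<bullet> (G x *v v) =
          (\<Sum>i\<in>UNIV. \<Sum>j\<in>UNIV. (G0 $ i $ j - G x $ i $ j) * (v $ i * v $ j))"
        by (simp add: inner_vec_def matrix_vector_mult_def sum_distrib_left algebra_simps
            flip: sum_subtractf)
      also have "\<dots> \<le> s x"
        unfolding s_def
      proof (intro sum_mono)
        fix i j
        have "(G0 $ i $ j - G x $ i $ j) * (v $ i * v $ j) \<le>
            \<bar>G0 $ i $ j - G x $ i $ j\<bar> * (\<bar>v $ i\<bar> * \<bar>v $ j\<bar>)"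
          by (metis abs_ge_self abs_mult)
        also have "\<dots> \<le> \<bar>G0 $ i $ j - G x $ i $ j\<bar> * (1 * 1)"
          by (intro mult_left_mono mult_mono n) auto
        finally show "(G0 $ i $ j - G x $ i $ j) * (v $ i * v $ j) \<le> \<bar>G x $ i $ j - G0 $ i $ j\<bar>"
          by simp
      qed
      finally show ?thesis using m(2)[OF v] elim by simp
    qed
    show ?case
    proof (intro allI impI)
      fix w assume w: "b \<bullet> w = 0" "w \<noteq> 0"
      then have "(1 / norm w) *\<^sub>R w \<in> K" unfolding K_def by simp
      from unit[OF this] have "(1 / norm w) * (1 / norm w) * (w \<bullet> (G x *v w)) > 0"
        by (simp add: matrix_vector_mult_scaleR)
      then show "w \<bullet> (G x *v w) > 0"
        by (metis zero_less_mult_pos divide_pos_pos mult_pos_pos w(2) zero_less_norm_iff zero_less_one)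
    qed
  qed
qed

section \<open>Curves in level sets\<close>

text \<open>The curve is \<open>g (x0 + t v)\<close>, where \<open>g\<close> is the local inverse of a perturbation \<open>\<Psi>\<close> of the identity
  with \<open>l (\<Psi> x - x0) = F x - F x0\<close> for \<open>l = dF(x0)\<close>. It solves \<open>\<sigma>' = h(\<sigma>)\<close> with smooth \<open>h\<close>, so
  smoothness follows by bootstrapping.\<close>

lemma smooth_level_curve:
  fixes F :: "'a::euclidean_space \<Rightarrow> real"
  assumes \<Omega>: "open \<Omega>" "x0 \<in> \<Omega>" and F: "smooth_on \<Omega> F"
    and b: "frechet_derivative F (at x0) b \<noteq> 0" and v: "frechet_derivative F (at x0) v = 0"
  obtains e \<sigma> where "e > 0" "smooth_on {-e<..<e} \<sigma>" "\<sigma> 0 = x0"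
    "\<And>t. t \<in> {-e<..<e} \<Longrightarrow> \<sigma> t \<in> \<Omega> \<and> F (\<sigma> t) = F x0"
    "(\<sigma> has_vector_derivative v) (at 0)"
proof -
  define F' where "F' = (\<lambda>x. frechet_derivative F (at x))"
  have F': "(F has_derivative F' x) (at x)" if "x \<in> \<Omega>" for x
    using smooth_on_has_derivative[OF F that] unfolding F'_def .
  have lin: "linear (F' x)" if "x \<in> \<Omega>" for x
    using F'[OF that] has_derivative_linear by blast
  have smF': "smooth_on \<Omega> (\<lambda>x. F' x w)" for w
    unfolding F'_def by (rule smooth_on_frechet_derivative[OF F])
  define l where "l = F' x0"
  have l: "linear l" unfolding l_def using lin \<Omega>(2) .
  then have bl: "bounded_linear l" by (rule linear_conv_bounded_linear[THEN iffD1])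
  \<comment> \<open>A direction transverse to the level set, scaled so that
    \<open>l a = 1\<close>.\<close>
  define a where "a = (1 / l b) *\<^sub>R b"
  have la: "l a = 1" using b l unfolding a_def l_def F'_def by (simp add: linear_cmul)
  have lv: "l v = 0" using v unfolding l_def F'_def .
  define U where "U = {x \<in> \<Omega>. F' x a \<noteq> 0}"
  have "open (\<Omega> \<inter> (\<lambda>x. F' x a) -` (- {0}))"
    by (intro continuous_open_preimage[OF smooth_on_continuous[OF smF'] \<Omega>(1)]) auto
  moreover have "\<Omega> \<inter> (\<lambda>x. F' x a) -` (- {0}) = U" unfolding U_def by auto
  ultimately have "open U" by simp
  have U: "x0 \<in> U" "U \<subseteq> \<Omega>" using \<Omega>(2) la unfolding U_def l_def by auto
  \<comment> \<open>Straightens the level set: in the direction \<open>a\<close> the linear part of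
    \<open>F\<close> is replaced by \<open>F\<close> itself, which gives
    \<open>l (\<Psi> x - x0) = F x - F x0\<close>. The derivative of \<Psi> at \<open>x0\<close> is
    the identity.\<close>
  define \<Psi> where "\<Psi> = (\<lambda>x. x + (F x - F x0 - l (x - x0)) *\<^sub>R a)"
  define \<Psi>' where "\<Psi>' = (\<lambda>x w. w + (F' x w - l w) *\<^sub>R a)"
  have \<Psi>': "(\<Psi> has_derivative \<Psi>' x) (at x)" if "x \<in> \<Omega>" for x
  proof -
    have "((\<lambda>x. l (x - x0)) has_derivative (\<lambda>w. l (w - 0))) (at x)"
      by (intro bounded_linear.has_derivative[OF bl] derivative_intros)
    then show ?thesis unfolding \<Psi>_def \<Psi>'_def
      by (auto intro!: derivative_eq_intros F'[OF that])
  qed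
  have bl\<Psi>': "bounded_linear (\<Psi>' x)" if "x \<in> \<Omega>" for x
    using \<Psi>'[OF that] has_derivative_bounded_linear by blast
  define B where "B = (\<lambda>x. Blinfun (\<Psi>' x))"
  have B: "blinfun_apply (B x) = \<Psi>' x" if "x \<in> \<Omega>" for x
    using bl\<Psi>'[OF that] unfolding B_def by (rule bounded_linear_Blinfun_apply)
  have contB: "continuous_on U B"
  proof (rule continuous_on_blinfun_componentwise)
    fix i :: 'a
    have "continuous_on U (\<lambda>x. F' x i)"
      using smooth_on_continuous[OF smF'] U(2) continuous_on_subset by blast
    then have "continuous_on U (\<lambda>x. \<Psi>' x i)"
      unfolding \<Psi>'_def by (intro continuous_intros)
    then show "continuous_on U (\<lambda>x. blinfun_apply (B x) i)"
      using B U(2) by (simp add: subset_iff cong: continuous_on_cong)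
  qed
  have idB: "id_blinfun o\<^sub>L B x0 = id_blinfun"
    by (intro blinfun_eqI) (simp add: B[OF \<Omega>(2)] \<Psi>'_def l_def)
  have der: "(\<Psi> has_derivative blinfun_apply (B x)) (at x)" if "x \<in> U" for x
    using \<Psi>' B U(2) that by (simp add: subset_iff)
  obtain U' V g g'
    where U': "U' \<subseteq> U" "x0 \<in> U'" and V: "open V" "\<Psi> x0 \<in> V" and hom: "homeomorphism U' V \<Psi> g"
      and g: "\<And>y. y \<in> V \<Longrightarrow> (g has_derivative g' y) (at y)"
      "\<And>y. y \<in> V \<Longrightarrow> g' y = inv (blinfun_apply (B (g y)))"
      "\<And>y. y \<in> V \<Longrightarrow> bij (blinfun_apply (B (g y)))"
    using inverse_function_theorem[OF \<open>open U\<close> der contB U(1) idB] by metis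
  have \<Psi>x0: "\<Psi> x0 = x0" using linear_0[OF l] unfolding \<Psi>_def by simp
  have gV: "g y \<in> U'" "\<Psi> (g y) = y" if "y \<in> V" for y
    using hom that unfolding homeomorphism_def by auto
  define p where "p = (\<lambda>t::real. x0 + t *\<^sub>R v)"
  have "open (p -` V)"
    by (intro open_vimage V(1)) (auto simp: p_def intro!: continuous_intros)
  moreover have "0 \<in> p -` V" using V(2) \<Psi>x0 by (simp add: p_def)
  ultimately obtain e where e: "e > 0" "ball 0 e \<subseteq> p -` V"
    unfolding open_contains_ball by blast
  define I where "I = {-e<..<e}"
  have pI: "p t \<in> V" if "t \<in> I" for t
    using e(2) that unfolding I_def by (auto simp: subset_iff dist_norm)
  have "open I" unfolding I_def by simp
  define \<sigma> where "\<sigma> = (\<lambda>t. g (p t))"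
  have \<sigma>U: "\<sigma> t \<in> U" if "t \<in> I" for t
    using gV(1)[OF pI[OF that]] U'(1) unfolding \<sigma>_def by auto
  have \<sigma>0: "\<sigma> 0 = x0"
    using hom U'(2) \<Psi>x0 unfolding \<sigma>_def p_def homeomorphism_def by auto
  have F\<sigma>: "F (\<sigma> t) = F x0" if "t \<in> I" for t
  proof -
    have "l (\<Psi> (\<sigma> t) - x0) = F (\<sigma> t) - F x0"
      unfolding \<Psi>_def using l la by (simp add: linear_diff linear_add linear_cmul)
    moreover have "\<Psi> (\<sigma> t) - x0 = t *\<^sub>R v"
      using gV(2)[OF pI[OF that]] unfolding \<sigma>_def p_def by simp
    ultimately show ?thesis using lv l by (simp add: linear_cmul)
  qed
  \<comment> \<open>The velocity \<open>s\<close> solves \<open>\<Psi>' (\<sigma> t) s = v\<close>.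
    Applying \<open>l\<close> gives \<open>F' (\<sigma> t) s = 0\<close>, so
    \<open>s = v + l s *\<^sub>R a\<close>, and the coefficient of \<open>a\<close> is fixed by
    \<open>F' (\<sigma> t) s = 0\<close> again.\<close>
  define h where "h = (\<lambda>x. v - (F' x v / F' x a) *\<^sub>R a)"
  have \<sigma>': "(\<sigma> has_derivative (\<lambda>r. r *\<^sub>R h (\<sigma> t))) (at t)" if t: "t \<in> I" for t
  proof -
    define s where "s = g' (p t) v"
    have lin\<sigma>: "linear (F' (\<sigma> t))" using lin \<sigma>U[OF t] U(2) by auto
    have ling: "linear (g' (p t))" using g(1)[OF pI[OF t]] has_derivative_linear by blast
    have "(p has_derivative (\<lambda>r. r *\<^sub>R v)) (at t)"
      unfolding p_def by (auto intro!: derivative_eq_intros)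
    from diff_chain_at[OF this g(1)[OF pI[OF t]]]
    have d: "(\<sigma> has_derivative (\<lambda>r. r *\<^sub>R s)) (at t)"
      unfolding s_def \<sigma>_def o_def using ling by (simp add: linear_cmul)
    have "\<Psi>' (\<sigma> t) s = v"
      unfolding s_def g(2)[OF pI[OF t]] using g(3)[OF pI[OF t]] B \<sigma>U[OF t] U(2)
      by (metis \<sigma>_def bij_is_surj subsetD surj_f_inv_f)
    then have eq: "s + (F' (\<sigma> t) s - l s) *\<^sub>R a = v" unfolding \<Psi>'_def .
    from arg_cong[OF this, of l] have Fs: "F' (\<sigma> t) s = 0"
      using l la lv by (simp add: linear_add linear_cmul)
    then have s: "s = v + l s *\<^sub>R a" using eq by (simp add: algebra_simps)
    from arg_cong[OF this, of "F' (\<sigma> t)"] have "0 = F' (\<sigma> t) v + l s * F' (\<sigma> t) a"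
      using lin\<sigma> Fs by (simp add: linear_add linear_cmul)
    moreover have "F' (\<sigma> t) a \<noteq> 0" using \<sigma>U[OF t] unfolding U_def by auto
    ultimately have "l s = - (F' (\<sigma> t) v / F' (\<sigma> t) a)" by (simp add: field_simps)
    then have "s = h (\<sigma> t)" using s unfolding h_def by simp
    then show ?thesis using d by simp
  qed
  have smh: "smooth_on U h"
    unfolding h_def using smF' smooth_on_subset[OF _ U(2)] \<open>open U\<close>
    by (intro smooth_on_diff smooth_on_scaleR smooth_on_const smooth_on_divide) (auto simp: U_def)
  \<comment> \<open>If \<sigma> has order \<open>k\<close>, so has its derivative
    \<open>h (\<sigma> t)\<close>, and \<sigma> has order \<open>k + 1\<close>.\<close>
  have "Ck_on k I \<sigma>" for k
  proof (induction k)
    case 0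
    show ?case using \<sigma>'
      by (auto intro!: continuous_at_imp_continuous_on has_derivative_continuous)
  next
    case (Suc k)
    show ?case
    proof (rule Ck_on_SucI[OF \<open>open I\<close> \<sigma>'])
      fix r :: real
      have "Ck_on k I (\<lambda>t. h (\<sigma> t))"
        using smh \<sigma>U by (intro Ck_on_compose[OF \<open>open I\<close> \<open>open U\<close> _ _ Suc])
          (auto simp: smooth_on_def)
      then show "Ck_on k I (\<lambda>t. r *\<^sub>R h (\<sigma> t))"
        using Ck_on_linear_comp[OF \<open>open I\<close> bounded_linear_scaleR_right] by blast
    qed
  qed
  then have "smooth_on I \<sigma>" unfolding smooth_on_def by blast
  moreover have "(\<sigma> has_vector_derivative v) (at 0)"
    using \<sigma>'[of 0] e(1) lv unfolding has_vector_derivative_def I_def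
    by (simp add: \<sigma>0 h_def l_def)
  ultimately show thesis
    using that[of e \<sigma>] e(1) \<sigma>0 \<sigma>U U(2) F\<sigma> unfolding I_def by (simp add: subset_iff)
qed

section \<open>Degenerate points of smooth families of symmetric matrices\<close>

text \<open>Otherwise \<open>x0\<close> would be a local maximum of \<open>F\<close> and the
  derivative would vanish there.\<close>

lemma frequently_pos_near_zero:
  fixes F :: "'a::real_normed_vector \<Rightarrow> real"
  assumes "(F has_derivative F') (at x0)" "F x0 = 0" "F' h \<noteq> 0"
  shows "\<exists>\<^sub>F x in nhds x0. F x > 0"
proof (rule ccontr)
  assume "\<not> (\<exists>\<^sub>F x in nhds x0. F x > 0)"
  then have "\<forall>\<^sub>F x in nhds x0. F x \<le> F x0"
    using assms(2) by (simp add: not_frequently not_less)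
  then obtain S where "open S" "x0 \<in> S" "\<forall>x\<in>S. F x \<le> F x0"
    unfolding eventually_nhds by blast
  then have "F' = (\<lambda>v. 0)"
    using assms(1) by (intro differential_zero_maxmin[of x0 S F F']) auto
  then show False using assms(3) by simp
qed

lemma smooth_on_adjugate_mv:
  fixes M :: "'a::euclidean_space \<Rightarrow> real^'n^'n"
  assumes "open S" "\<And>i j. smooth_on S (\<lambda>x. M x $ i $ j)"
  shows "smooth_on S (\<lambda>x. adjugate_mv (M x) b)"
proof (rule smooth_on_vec[OF assms(1)])
  fix k
  have "smooth_on S (\<lambda>x. replace_row (M x) j (axis k 1) $ i $ l)" for j i l
    using assms by (cases "i = j") (auto simp: replace_row_def smooth_on_const)
  then have "smooth_on S (\<lambda>x. \<Sum>j\<in>UNIV. b $ j * det (replace_row (M x) j (axis k 1)))"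
    by (intro smooth_on_sum smooth_on_mult smooth_on_det smooth_on_const assms(1))
  then show "smooth_on S (\<lambda>x. adjugate_mv (M x) b $ k)"
    by (simp add: adjugate_mv_def)
qed

lemma smooth_on_matrix_vector_mult:
  fixes M :: "'a::euclidean_space \<Rightarrow> real^'n^'n"
  assumes "open S" "\<And>i j. smooth_on S (\<lambda>x. M x $ i $ j)" "smooth_on S w"
  shows "smooth_on S (\<lambda>x. M x *v w x)"
proof (rule smooth_on_vec[OF assms(1)])
  fix i
  show "smooth_on S (\<lambda>x. (M x *v w x) $ i)"
    unfolding matrix_vector_mult_def
    using assms by (simp add: smooth_on_sum smooth_on_mult smooth_on_vec_nth)
qed

text \<open>For \<open>a\<close> in the kernel of \<open>M x0\<close>, differentiate
  \<open>(M x a) \<bullet> adj (M x) a = det (M x) (a \<bullet> a)\<close> at \<open>x0\<close>.\<close>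

lemma adjugate_mv_nonzero:
  fixes M :: "'a::euclidean_space \<Rightarrow> real^'n^'n"
  assumes S: "open S" "x0 \<in> S" and M: "\<And>i j. smooth_on S (\<lambda>x. M x $ i $ j)"
    and sym: "\<And>x. x \<in> S \<Longrightarrow> transpose (M x) = M x"
    and a: "M x0 *v a = 0" "a \<noteq> 0"
    and D: "frechet_derivative (\<lambda>x. det (M x)) (at x0) h \<noteq> 0"
  shows "adjugate_mv (M x0) a \<noteq> 0"
proof
  assume 0: "adjugate_mv (M x0) a = 0"
  define P where "P = (\<lambda>x. M x *v a)"
  define Q where "Q = (\<lambda>x. adjugate_mv (M x) a)"
  have P: "(P has_derivative frechet_derivative P (at x0)) (at x0)"
    unfolding P_def by (intro smooth_on_has_derivative[OF smooth_on_matrix_vector_mult S(2)]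
        S M smooth_on_const)
  have Q: "(Q has_derivative frechet_derivative Q (at x0)) (at x0)"
    unfolding Q_def by (intro smooth_on_has_derivative[OF smooth_on_adjugate_mv S(2)] S M)
  have D': "((\<lambda>x. det (M x)) has_derivative frechet_derivative (\<lambda>x. det (M x)) (at x0)) (at x0)"
    by (intro smooth_on_has_derivative[OF smooth_on_det S(2)] S M)
  \<comment> \<open>Both factors vanish at \<open>x0\<close>, so the product rule leaves the zero
    derivative, while the product is a nonzero multiple of \<open>det (M x)\<close>.\<close>
  have "((\<lambda>x. P x \<bullet> Q x) has_derivative
      (\<lambda>v. P x0 \<bullet> frechet_derivative Q (at x0) v + frechet_derivative P (at x0) v \<bullet> Q x0)) (at x0)"
    using P Q by (rule has_derivative_inner)
  then have "((\<lambda>x. P x \<bullet> Q x) has_derivative (\<lambda>v. 0)) (at x0)"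
    using a(1) 0 by (simp add: P_def Q_def)
  moreover have "P x \<bullet> Q x = det (M x) * (a \<bullet> a)" if "x \<in> S" for x
  proof -
    have "P x \<bullet> Q x = a \<bullet> (M x *v Q x)"
      using symmetric_matrix_inner[OF sym[OF that], of a "Q x"] unfolding P_def
      by (simp add: inner_commute)
    then show ?thesis unfolding Q_def matrix_adjugate_mv by simp
  qed
  ultimately have "((\<lambda>x. det (M x) * (a \<bullet> a)) has_derivative (\<lambda>v. 0)) (at x0)"
    by (rule has_derivative_transform_within_open[OF _ S])
  moreover have "((\<lambda>x. det (M x) * (a \<bullet> a)) has_derivative
      (\<lambda>v. frechet_derivative (\<lambda>x. det (M x)) (at x0) v * (a \<bullet> a))) (at x0)"
    using D' by (rule has_derivative_mult_left)
  ultimately have "(\<lambda>v. 0) = (\<lambda>v. frechet_derivative (\<lambda>x. det (M x)) (at x0) v * (a \<bullet> a))"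
    by (rule has_derivative_unique)
  from fun_cong[OF this, of h] show False using D a(2) by simp
qed

text \<open>Supplies the data at a single point; both inequalities are stable under small
  perturbations, so the construction of the metric can be carried out on a neighbourhood.\<close>

lemma lorentzian_prescription_covector:
  fixes M :: "'a::euclidean_space \<Rightarrow> real^'n^'n"
  assumes S: "open S" "x0 \<in> S" and M: "\<And>i j. smooth_on S (\<lambda>x. M x $ i $ j)"
    and sym: "\<And>x. x \<in> S \<Longrightarrow> transpose (M x) = M x"
    and type: "\<And>x. x \<in> S \<Longrightarrow> det (M x) \<noteq> 0 \<Longrightarrow> pos_def (M x) \<or> (\<exists>e k. lorentz_basis (M x) e k)"
    and D: "det (M x0) = 0 \<Longrightarrow> \<exists>h. frechet_derivative (\<lambda>x. det (M x)) (at x0) h \<noteq> 0"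
  obtains b where "b \<noteq> 0" "b \<bullet> adjugate_mv (M x0) b > 0"
    "\<And>w. b \<bullet> w = 0 \<Longrightarrow> w \<noteq> 0 \<Longrightarrow> w \<bullet> (M x0 *v w) > 0"
proof -
  \<comment> \<open>With \<open>y = adjugate_mv G b\<close>, the form satisfies
    \<open>y \<bullet> (G *v y) = det G * (b \<bullet> y)\<close>, and both the left side and
    \<open>det G\<close> are positive.\<close>
  have pos: "b \<bullet> adjugate_mv G b > 0" if "pos_def G" "b \<noteq> 0" for G :: "real^'n^'n" and b
  proof -
    have d: "det G > 0" using pos_def_det_pos[OF that(1)] .
    then have "adjugate_mv G b \<noteq> 0"
      using matrix_adjugate_mv[of G b] that(2) by auto
    then have "adjugate_mv G b \<bullet> (G *v adjugate_mv G b) > 0"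
      using that(1) unfolding pos_def_def by blast
    then show ?thesis using d unfolding matrix_adjugate_mv
      by (simp add: inner_commute zero_less_mult_iff)
  qed
  consider "pos_def (M x0)" | e k where "lorentz_basis (M x0) e k" | "det (M x0) = 0"
    using type[OF S(2)] by blast
  then show thesis
  proof cases
    case 1
    have "(axis undefined 1 :: real^'n) \<noteq> 0" by (simp add: axis_eq_0_iff)
    then show thesis using that pos[OF 1] 1 unfolding pos_def_def by blast
  next
    case (2 e k)
    note d = lorentz_basis_det(1)[OF 2]
    have ek: "e k \<bullet> (M x0 *v e k) = -1" using 2 unfolding lorentz_basis_def by simp
    define b where "b = M x0 *v e k"
    \<comment> \<open>Both vectors are sent by \<open>M x0\<close> to
      \<open>det (M x0) *\<^sub>R b\<close>, so by invertibility they agree. Then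
      \<open>b \<bullet> adjugate_mv (M x0) b = - det (M x0)\<close>, which is positive.\<close>
    have "M x0 *v (adjugate_mv (M x0) b - det (M x0) *\<^sub>R e k) = 0"
      unfolding matrix_vector_mult_diff_distrib matrix_adjugate_mv
      by (simp add: b_def matrix_vector_mult_scaleR)
    moreover have "invertible (M x0)" using d by (simp add: invertible_det_nz)
    ultimately have "adjugate_mv (M x0) b = det (M x0) *\<^sub>R e k"
      by (metis eq_iff_diff_eq_0 inj_matrix_vector_mult injD matrix_vector_mult_0_right)
    then have adj: "b \<bullet> adjugate_mv (M x0) b > 0"
      using ek d unfolding b_def by (simp add: inner_commute)
    have b0: "b \<noteq> 0" using ek unfolding b_def by auto
    have "w \<bullet> (M x0 *v w) > 0" if "b \<bullet> w = 0" "w \<noteq> 0" for w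
      using that symmetric_matrix_inner[OF sym[OF S(2)], of w "e k"]
      by (intro lorentz_basis_pos[OF 2]) (auto simp: b_def inner_commute)
    then show thesis by (rule that[OF b0 adj])
  next
    case 3
    obtain h where h: "frechet_derivative (\<lambda>x. det (M x)) (at x0) h \<noteq> 0" using D 3 by blast
    have smdet: "smooth_on S (\<lambda>x. det (M x))" by (rule smooth_on_det[OF S(1) M])
    have "\<exists>\<^sub>F x in nhds x0. det (M x) > 0"
      by (rule frequently_pos_near_zero[OF smooth_on_has_derivative[OF smdet S(2)] 3 h])
    moreover have "\<forall>\<^sub>F x in nhds x0. x \<in> S" using S by (rule eventually_nhds_in_open)
    ultimately have   "\<exists>\<^sub>F x in nhds x0. det (M x) > 0 \<and> x \<in> S"
      by (rule frequently_eventually_frequently)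
    \<comment> \<open>A Lorentzian matrix has negative determinant, so points of positive
      determinant are Riemannian.\<close>
    then have freq: "\<exists>\<^sub>F x in nhds x0. pos_def (M x) \<and> x \<in> S"
    proof (rule frequently_elim1)
      fix x assume "det (M x) > 0 \<and> x \<in> S"
      then show "pos_def (M x) \<and> x \<in> S"
        using type[of x] lorentz_basis_det(1) by (metis less_numeral_extra(3) order_less_asym)
    qed
    \<comment> \<open>Riemannian points accumulate at \<open>x0\<close>, so weak inequalities valid
      at them hold at \<open>x0\<close> by continuity.\<close>
    have limit: "q x0 \<ge> 0" if q: "smooth_on S q" "\<And>x. x \<in> S \<Longrightarrow> pos_def (M x) \<Longrightarrow> q x \<ge> 0"
      for q :: "'a \<Rightarrow> real"
    proof (rule ccontr)
      assume "\<not> q x0 \<ge> 0"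
      have "isCont q x0"
        using smooth_on_continuous[OF q(1)] S continuous_on_eq_continuous_at by blast
      then have "(q \<longlongrightarrow> q x0) (nhds x0)"
        by (simp add: continuous_at tendsto_at_iff_tendsto_nhds)
      then have "\<forall>\<^sub>F x in nhds x0. q x < 0" using \<open>\<not> q x0 \<ge> 0\<close> by (intro order_tendstoD) auto
      with freq have "\<exists>\<^sub>F x in nhds x0. (pos_def (M x) \<and> x \<in> S) \<and> q x < 0"
        by (rule frequently_eventually_frequently)
      then show False using q(2) frequently_ex by fastforce
    qed
    have psd: "w \<bullet> (M x0 *v w) \<ge> 0" for w
    proof (rule limit)
      show "smooth_on S (\<lambda>x. w \<bullet> (M x *v w))"
        by (intro smooth_on_inner smooth_on_matrix_vector_mult smooth_on_const S M)
      show "w \<bullet> (M x *v w) \<ge> 0" if "pos_def (M x)" for x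
        using that unfolding pos_def_def by (cases "w = 0") (auto intro: less_imp_le)
    qed
    have "\<not> invertible (M x0)" using 3 by (simp add: invertible_det_nz)
    then obtain b where b: "M x0 *v b = 0" "b \<noteq> 0"
      by (metis invertible_left_inverse matrix_left_invertible_ker)
    have V: "adjugate_mv (M x0) b \<noteq> 0" by (rule adjugate_mv_nonzero[OF S M sym b h])
    \<comment> \<open>The kernel is the line spanned by the adjugate image of \<open>b\<close>. As
      \<open>b\<close> lies in it, the two vectors are nonzero multiples of each other, and
      \<open>b \<bullet> adjugate_mv (M x0) b\<close> cannot vanish; its sign comes from the
      limit.\<close>
    obtain r where "b = r *\<^sub>R adjugate_mv (M x0) b"
      using adjugate_mv_spans_kernel[OF V 3 b(1)] .
    then have m: "adjugate_mv (M x0) b = inverse r *\<^sub>R b" and "r \<noteq> 0"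
      using b(2) by (metis scaleR_left.zero scaleR_scaleR left_inverse scaleR_one, metis scaleR_zero_left)
    have ker: "\<exists>s. w = s *\<^sub>R b" if w: "M x0 *v w = 0" for w
    proof -
      obtain s where "w = s *\<^sub>R adjugate_mv (M x0) b"
        using adjugate_mv_spans_kernel[OF V 3 w] .
      then show ?thesis by (metis m scaleR_scaleR)
    qed
    have "b \<bullet> adjugate_mv (M x0) b \<noteq> 0" unfolding m using b(2) \<open>r \<noteq> 0\<close> by simp
    moreover have "b \<bullet> adjugate_mv (M x0) b \<ge> 0"
    proof (rule limit)
      show "smooth_on S (\<lambda>x. b \<bullet> adjugate_mv (M x) b)"
        by (intro smooth_on_inner smooth_on_adjugate_mv smooth_on_const S M)
    qed (use pos b(2) less_imp_le in blast)
    ultimately have "b \<bullet> adjugate_mv (M x0) b > 0" by simp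
    \<comment> \<open>A null vector of a semidefinite form lies in its kernel, here a line through
      \<open>b\<close>, which meets the orthogonal complement of \<open>b\<close> only in 0.\<close>
    moreover have "w \<bullet> (M x0 *v w) > 0" if w: "b \<bullet> w = 0" "w \<noteq> 0" for w
    proof (rule ccontr)
      assume "\<not> w \<bullet> (M x0 *v w) > 0"
      then have "w \<bullet> (M x0 *v w) = 0" using psd[of w] by simp
      then have "M x0 *v w = 0" by (rule psd_kernel[OF sym[OF S(2)] psd])
      then obtain r where "w = r *\<^sub>R b" using ker by blast
      then show False using w b(2) by simp
    qed
    ultimately show thesis using that b(2) by blast
  qed
qed

section \<open>Charts and tangent spaces\<close>

text \<open>Inverse to reading off components in the chart \<open>c\<close>; together they identify
  the tangent space at \<open>p\<close> with \<open>real^'n\<close>.\<close>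

definition tvec_of :: "('a, 'n::finite) chart set \<Rightarrow> ('a, 'n) chart \<Rightarrow> 'a \<Rightarrow> real^'n \<Rightarrow> ('a, 'n) tvec" where
  "tvec_of A c p x =
     (\<lambda>c'. if c' \<in> charts_at A p then frechet_derivative (transition c c') (at (coord c p)) x else 0)"

lemma coord_vec_eq_tvec_of: "coord_vec A c p i = tvec_of A c p (axis i 1)"
  by (simp add: coord_vec_def tvec_of_def)

locale smooth_atlas =
  fixes X :: "'a topology" and A :: "('a, 'n::finite) chart set"
  assumes smooth_structure: "smooth_structure X A"
begin

section \<open>Topology of charts and their inverses\<close>

lemma openin_cdom: "c \<in> A \<Longrightarrow> openin X (cdom c)"
  using smooth_structure unfolding smooth_structure_def topological_chart_def by blast

lemma homeomorphic_coord:
  "c \<in> A \<Longrightarrow> homeomorphic_map (subtopology X (cdom c)) (top_of_set (coord c ` cdom c)) (coord c)"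
  using smooth_structure unfolding smooth_structure_def topological_chart_def by blast

lemma open_coord_image_cdom: "c \<in> A \<Longrightarrow> open (coord c ` cdom c)"
  using smooth_structure unfolding smooth_structure_def topological_chart_def by blast

lemma topspace_cdom: "c \<in> A \<Longrightarrow> topspace (subtopology X (cdom c)) = cdom c"
  using openin_subset[OF openin_cdom] by auto

lemma inj_on_coord: "c \<in> A \<Longrightarrow> inj_on (coord c) (cdom c)"
  using homeomorphic_imp_injective_map[OF homeomorphic_coord] topspace_cdom by metis

lemma chart_inv_coord [simp]: "c \<in> A \<Longrightarrow> p \<in> cdom c \<Longrightarrow> chart_inv c (coord c p) = p"
  unfolding chart_inv_def using inj_on_coord inv_into_f_f by metis

lemma coord_chart_inv: "x \<in> coord c ` cdom c \<Longrightarrow> coord c (chart_inv c x) = x"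
  unfolding chart_inv_def by (rule f_inv_into_f)

lemma chart_inv_mem: "c \<in> A \<Longrightarrow> S \<subseteq> cdom c \<Longrightarrow> x \<in> coord c ` S \<Longrightarrow> chart_inv c x \<in> S"
  by (auto simp: subset_iff)

lemma open_coord_image:
  assumes "c \<in> A" "openin X W"
  shows "open (coord c ` (cdom c \<inter> W))"
proof -
  have "openin (subtopology X (cdom c)) (cdom c \<inter> W)"
    using assms(2) by (simp add: openin_subtopology_Int2)
  then have "openin (top_of_set (coord c ` cdom c)) (coord c ` (cdom c \<inter> W))"
    using homeomorphic_imp_open_map[OF homeomorphic_coord[OF assms(1)]] unfolding open_map_def by blast
  then show ?thesis
    using open_coord_image_cdom[OF assms(1)] openin_open_trans by blast
qed

lemma openin_coord_preimage:
  assumes "c \<in> A" "open S"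
  shows "openin X {p \<in> cdom c. coord c p \<in> S}"
proof -
  have "continuous_map (subtopology X (cdom c)) (top_of_set (coord c ` cdom c)) (coord c)"
    using homeomorphic_imp_continuous_map[OF homeomorphic_coord[OF assms(1)]] .
  then have "openin (subtopology X (cdom c))
      {p \<in> topspace (subtopology X (cdom c)). coord c p \<in> coord c ` cdom c \<inter> S}"
    by (rule openin_continuous_map_preimage) (use assms(2) in auto)
  moreover have "{p \<in> topspace (subtopology X (cdom c)). coord c p \<in> coord c ` cdom c \<inter> S} =
      {p \<in> cdom c. coord c p \<in> S}"
    using topspace_cdom[OF assms(1)] by auto
  ultimately show ?thesis
    using openin_trans_full[OF _ openin_cdom[OF assms(1)]] by simp
qed

lemma continuous_map_chart_inv:
  assumes "c \<in> A"
  shows "continuous_map (top_of_set (coord c ` cdom c)) X (chart_inv c)"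
  unfolding continuous_map_def
proof (intro conjI allI impI)
  show "chart_inv c \<in> topspace (top_of_set (coord c ` cdom c)) \<rightarrow> topspace X"
    using assms openin_subset[OF openin_cdom[OF assms]] by auto
  fix W assume "openin X W"
  then have "open (coord c ` (cdom c \<inter> W))" by (rule open_coord_image[OF assms])
  moreover have "{x \<in> topspace (top_of_set (coord c ` cdom c)). chart_inv c x \<in> W} = coord c ` (cdom c \<inter> W)"
    using assms by auto
  ultimately show "openin (top_of_set (coord c ` cdom c))
      {x \<in> topspace (top_of_set (coord c ` cdom c)). chart_inv c x \<in> W}"
    by (auto intro: open_subset)
qed

lemma chart_around: "p \<in> topspace X \<Longrightarrow> \<exists>c. c \<in> charts_at A p"
  using smooth_structure unfolding smooth_structure_def charts_at_def by blast

lemma charts_atD: "c \<in> charts_at A p \<Longrightarrow> c \<in> A" "c \<in> charts_at A p \<Longrightarrow> p \<in> cdom c"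
  unfolding charts_at_def by auto

section \<open>Differentials of coordinate changes\<close>

lemma smooth_transition:
  "c \<in> A \<Longrightarrow> c' \<in> A \<Longrightarrow> smooth_on (coord c ` (cdom c \<inter> cdom c')) (transition c c')"
  using smooth_structure unfolding smooth_structure_def compatible_def by blast

lemma transition_coord: "c \<in> A \<Longrightarrow> p \<in> cdom c \<Longrightarrow> transition c c' (coord c p) = coord c' p"
  unfolding transition_def by simp

lemma transition_has_derivative:
  assumes "c \<in> charts_at A p" "c' \<in> charts_at A p"
  shows "(transition c c' has_derivative frechet_derivative (transition c c') (at (coord c p))) (at (coord c p))"
  using smooth_on_has_derivative[OF smooth_transition] assms unfolding charts_at_def by blast

lemma linear_transition_derivative:
  assumes "c \<in> charts_at A p" "c' \<in> charts_at A p"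
  shows "linear (frechet_derivative (transition c c') (at (coord c p)))"
  using transition_has_derivative[OF assms] has_derivative_linear by blast

text \<open>The chain rule on the overlap of the charts; this cocycle identity makes
  \<open>tvec_of\<close> a tangent vector.\<close>

lemma transition_derivative_compose:
  assumes c: "c \<in> charts_at A p" "c' \<in> charts_at A p" "c'' \<in> charts_at A p"
  shows "frechet_derivative (transition c' c'') (at (coord c' p))
      (frechet_derivative (transition c c') (at (coord c p)) x) =
    frechet_derivative (transition c c'') (at (coord c p)) x"
proof -
  note A = charts_atD(1)[OF c(1)] charts_atD(1)[OF c(2)] charts_atD(1)[OF c(3)]
  note P = charts_atD(2)[OF c(1)] charts_atD(2)[OF c(2)] charts_atD(2)[OF c(3)]
  have d: "(transition c' c'' has_derivative frechet_derivative (transition c' c'') (at (coord c' p)))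
      (at (transition c c' (coord c p)))"
    using transition_has_derivative[OF c(2,3)] transition_coord[OF A(1) P(1)] by simp
  have "((transition c' c'' \<circ> transition c c') has_derivative
      (frechet_derivative (transition c' c'') (at (coord c' p)) \<circ>
       frechet_derivative (transition c c') (at (coord c p)))) (at (coord c p))"
    by (rule diff_chain_at[OF transition_has_derivative[OF c(1,2)] d])
  moreover have "(transition c' c'' \<circ> transition c c') y = transition c c'' y"
    if "y \<in> coord c ` (cdom c \<inter> cdom c')" for y
    using that A transition_coord by auto
  ultimately have "(transition c c'' has_derivative
      (frechet_derivative (transition c' c'') (at (coord c' p)) \<circ>
       frechet_derivative (transition c c') (at (coord c p)))) (at (coord c p))"
    using P(1,2)
      has_derivative_transform_within_open[OF _ open_coord_image[OF A(1) openin_cdom[OF A(2)]], of _ _ "coord c p" UNIV]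
    by blast
  from frechet_derivative_at[OF this] show ?thesis by (metis comp_apply)
qed

lemma transition_derivative_self:
  assumes "c \<in> charts_at A p"
  shows "frechet_derivative (transition c c) (at (coord c p)) x = x"
proof -
  note A = charts_atD(1)[OF assms]
  have "((\<lambda>x. x) has_derivative (\<lambda>x. x)) (at (coord c p))" by simp
  then have "(transition c c has_derivative (\<lambda>x. x)) (at (coord c p))"
  proof (rule has_derivative_transform_within_open[OF _ open_coord_image_cdom[OF A]])
    show "coord c p \<in> coord c ` cdom c" using charts_atD(2)[OF assms] by blast
    show "y = transition c c y" if "y \<in> coord c ` cdom c" for y
      using that transition_coord[OF A] by auto
  qed
  from frechet_derivative_at[OF this] show ?thesis by metis
qed

section \<open>Tangent vectors and their components\<close>

lemma tvec_of_mem: "c \<in> charts_at A p \<Longrightarrow> tvec_of A c p x \<in> tangent_space A p"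
  unfolding tangent_space_def tvec_of_def using transition_derivative_compose by auto

lemma tvec_of_self [simp]: "c \<in> charts_at A p \<Longrightarrow> tvec_of A c p x c = x"
  unfolding tvec_of_def using transition_derivative_self by simp

lemma tangent_transition:
  "w \<in> tangent_space A p \<Longrightarrow> c \<in> charts_at A p \<Longrightarrow> c' \<in> charts_at A p \<Longrightarrow>
    w c' = frechet_derivative (transition c c') (at (coord c p)) (w c)"
  unfolding tangent_space_def by blast

lemma tvec_of_tangent:
  assumes "w \<in> tangent_space A p" "c \<in> charts_at A p"
  shows "tvec_of A c p (w c) = w"
proof
  fix c'
  show "tvec_of A c p (w c) c' = w c'"
  proof (cases "c' \<in> charts_at A p")
    case True
    then show ?thesis unfolding tvec_of_def tangent_transition[OF assms True] by simp
  next
    case False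
    then show ?thesis using assms(1) unfolding tvec_of_def tangent_space_def by simp
  qed
qed

lemma tangent_eqI:
  "w \<in> tangent_space A p \<Longrightarrow> w' \<in> tangent_space A p \<Longrightarrow> c \<in> charts_at A p \<Longrightarrow> w c = w' c \<Longrightarrow> w = w'"
  using tvec_of_tangent by metis

lemma tvec_of_add: "c \<in> charts_at A p \<Longrightarrow> tvec_of A c p (x + y) = tv_add (tvec_of A c p x) (tvec_of A c p y)"
  by (auto simp: tvec_of_def tv_add_def linear_add[OF linear_transition_derivative])

lemma tvec_of_scaleR: "c \<in> charts_at A p \<Longrightarrow> tvec_of A c p (a *\<^sub>R x) = tv_scale a (tvec_of A c p x)"
  by (auto simp: tvec_of_def tv_scale_def linear_cmul[OF linear_transition_derivative])

lemma tvec_of_0: "c \<in> charts_at A p \<Longrightarrow> tvec_of A c p 0 = tv_zero"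
  using tvec_of_scaleR[of c p 0 0] by (simp add: tv_scale_def)

lemma tangent_space_add:
  assumes "u \<in> tangent_space A p" "v \<in> tangent_space A p" "c \<in> charts_at A p"
  shows "tv_add u v \<in> tangent_space A p"
  using tvec_of_mem[OF assms(3), of "u c + v c"] tvec_of_tangent[OF _ assms(3)] assms tvec_of_add by metis

lemma tangent_space_scale:
  assumes "u \<in> tangent_space A p" "c \<in> charts_at A p"
  shows "tv_scale a u \<in> tangent_space A p"
  using tvec_of_mem[OF assms(2), of "a *\<^sub>R u c"] tvec_of_tangent[OF _ assms(2)] assms tvec_of_scaleR by metis

lemma tv_zero_mem: "c \<in> charts_at A p \<Longrightarrow> tv_zero \<in> tangent_space A p"
  using tvec_of_mem[of c p 0] tvec_of_0 by metis

lemma tangent_eq_zero_iff: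
  "w \<in> tangent_space A p \<Longrightarrow> c \<in> charts_at A p \<Longrightarrow> w = tv_zero \<longleftrightarrow> w c = 0"
  using tangent_eqI[OF _ tv_zero_mem] by auto

subsection \<open>Symmetric bilinear forms in coordinates\<close>

text \<open>Expansion in coordinate vectors; it reduces every statement about forms on a tangent
  space to the matrix of components.\<close>

lemma bilinear_components:
  assumes B: "symmetric_bilinear A p (g p)" and c: "c \<in> charts_at A p"
    and xy: "x \<in> tangent_space A p" "y \<in> tangent_space A p"
  shows "g p x y = x c \<bullet> (components A g c p *v y c)"
proof -
  let ?t = "tvec_of A c p"
  have t: "?t u \<in> tangent_space A p" for u using tvec_of_mem[OF c] .
  have l1: "linear (\<lambda>u. g p (?t u) w)" if "w \<in> tangent_space A p" for w
    using B t that unfolding symmetric_bilinear_def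
    by (intro linearI) (auto simp: tvec_of_add[OF c] tvec_of_scaleR[OF c])
  have sym: "g p (?t u) (?t v) = g p (?t v) (?t u)" for u v
    using B t unfolding symmetric_bilinear_def by blast
  have ex: "u = (\<Sum>i\<in>UNIV. u $ i *\<^sub>R axis i 1)" for u :: "real^'n"
    using basis_expansion[of u] by (simp add: scalar_mult_eq_scaleR)
  have e1: "g p (?t u) w = (\<Sum>i\<in>UNIV. u $ i * g p (?t (axis i 1)) w)" if "w \<in> tangent_space A p" for u w
    by (subst ex) (simp add: linear_sum[OF l1[OF that]] linear_cmul[OF l1[OF that]])
  have e2: "g p (?t u) (?t v) = (\<Sum>j\<in>UNIV. v $ j * g p (?t u) (?t (axis j 1)))" for u v
    using e1[OF t, of v u] by (simp add: sym)
  have "g p x y = g p (?t (x c)) (?t (y c))"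
    using tvec_of_tangent[OF _ c] xy by simp
  also have "\<dots> = (\<Sum>i\<in>UNIV. x c $ i * (\<Sum>j\<in>UNIV. y c $ j * g p (?t (axis i 1)) (?t (axis j 1))))"
    by (simp add: e1[OF t, of "x c"] e2[of "axis i 1" "y c" for i])
  also have "\<dots> = x c \<bullet> (components A g c p *v y c)"
    by (simp add: inner_vec_def matrix_vector_mult_def components_def coord_vec_eq_tvec_of mult.commute)
  finally show ?thesis .
qed

lemma transpose_components:
  "symmetric_bilinear A p (g p) \<Longrightarrow> c \<in> charts_at A p \<Longrightarrow> transpose (components A g c p) = components A g c p"
  unfolding symmetric_bilinear_def
  by (simp add: components_def coord_vec_eq_tvec_of tvec_of_mem transpose_def vec_eq_iff)

text \<open>Testing \<open>w\<close> against the tangent vector with components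
  \<open>z = G *v w c\<close>, where \<open>G\<close> is the component matrix, gives
  \<open>z \<bullet> z = 0\<close>.\<close>

lemma radical_iff:
  assumes B: "symmetric_bilinear A p (g p)" and c: "c \<in> charts_at A p"
  shows "w \<in> radical A g p \<longleftrightarrow> w \<in> tangent_space A p \<and> components A g c p *v w c = 0"
proof -
  have "components A g c p *v w c = 0"
    if w: "w \<in> tangent_space A p" "\<forall>v\<in>tangent_space A p. g p w v = 0"
  proof -
    let ?z = "components A g c p *v w c"
    have "g p w (tvec_of A c p ?z) = 0" using w(2) tvec_of_mem[OF c] by blast
    then have "w c \<bullet> (components A g c p *v ?z) = 0"
      using bilinear_components[of p g, OF B c w(1) tvec_of_mem[OF c]] c by simp
    then have "?z \<bullet> ?z = 0"
      using symmetric_matrix_inner[OF transpose_components[of p g, OF B c], of "w c" ?z] by simp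
    then show ?thesis by simp
  qed
  moreover have "g p w v = 0" if "w \<in> tangent_space A p" "v \<in> tangent_space A p"
    "components A g c p *v w c = 0" for v
    using bilinear_components[of p g, OF B c that(1,2)] that(3)
      symmetric_matrix_inner[OF transpose_components[of p g, OF B c], of "w c" "v c"] by simp
  ultimately show ?thesis unfolding radical_def by auto
qed

lemma radical_trivial_iff:
  assumes B: "symmetric_bilinear A p (g p)" and c: "c \<in> charts_at A p"
  shows "radical A g p = {tv_zero} \<longleftrightarrow> det (components A g c p) \<noteq> 0"
proof -
  let ?G = "components A g c p"
  have 0: "tv_zero \<in> radical A g p"
    using radical_iff[of p g, OF B c] tv_zero_mem[OF c] by simp
  have "radical A g p = {tv_zero} \<longleftrightarrow> (\<forall>x. ?G *v x = 0 \<longrightarrow> x = 0)"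
  proof
    assume R: "radical A g p = {tv_zero}"
    show "\<forall>x. ?G *v x = 0 \<longrightarrow> x = 0"
    proof (intro allI impI)
      fix x assume "?G *v x = 0"
      then have "tvec_of A c p x \<in> radical A g p"
        using radical_iff[of p g, OF B c] tvec_of_mem[OF c] c by simp
      then have "tvec_of A c p x = tv_zero" using R by simp
      then show "x = 0" using tvec_of_self[OF c, of x] by simp
    qed
  next
    assume "\<forall>x. ?G *v x = 0 \<longrightarrow> x = 0"
    then have "w = tv_zero" if "w \<in> radical A g p" for w
    proof -
      have w: "w \<in> tangent_space A p" "?G *v w c = 0"
        using that radical_iff[of p g, OF B c, of w] by blast+
      then show ?thesis
        using \<open>\<forall>x. ?G *v x = 0 \<longrightarrow> x = 0\<close> w(2) tangent_eq_zero_iff[OF w(1) c] by metis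
    qed
    then show "radical A g p = {tv_zero}" using 0 by blast
  qed
  also have "\<dots> \<longleftrightarrow> det ?G \<noteq> 0"
    unfolding matrix_left_invertible_ker[symmetric] invertible_left_inverse[symmetric] invertible_det_nz ..
  finally show ?thesis .
qed

lemma pos_def_components:
  assumes B: "symmetric_bilinear A p (g p)" and c: "c \<in> charts_at A p"
    and pos: "positive_definite_at A g p"
  shows "pos_def (components A g c p)"
  unfolding pos_def_def
proof (intro conjI allI impI)
  show "transpose (components A g c p) = components A g c p"
    using transpose_components[of p g, OF B c] .
  fix w :: "real^'n" assume "w \<noteq> 0"
  then have "tvec_of A c p w \<noteq> tv_zero"
    using tangent_eq_zero_iff[OF tvec_of_mem[OF c] c, of w] c by simp
  then have "g p (tvec_of A c p w) (tvec_of A c p w) > 0"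
    using pos tvec_of_mem[OF c] unfolding positive_definite_at_def by blast
  then show "w \<bullet> (components A g c p *v w) > 0"
    using bilinear_components[of p g, OF B c tvec_of_mem[OF c] tvec_of_mem[OF c]] c by simp
qed

lemma lorentzian_at_iff:
  assumes B: "symmetric_bilinear A p (g p)" and c: "c \<in> charts_at A p"
  shows "lorentzian_at A g p \<longleftrightarrow> (\<exists>e k. lorentz_basis (components A g c p) e k)"
proof
  assume "lorentzian_at A g p"
  then obtain e :: "'n \<Rightarrow> ('a, 'n) tvec" and k where e: "\<And>i. e i \<in> tangent_space A p"
    "\<And>i j. g p (e i) (e j) = (if i \<noteq> j then 0 else if i = k then -1 else 1)"
    unfolding lorentzian_at_def by blast
  have "lorentz_basis (components A g c p) (\<lambda>i. e i c) k"
    unfolding lorentz_basis_def using bilinear_components[of p g, OF B c e(1) e(1)] e(2) by metis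
  then show "\<exists>e k. lorentz_basis (components A g c p) e k" by blast
next
  assume "\<exists>e k. lorentz_basis (components A g c p) e k"
  then obtain e k where e: "lorentz_basis (components A g c p) e k" by blast
  show "lorentzian_at A g p"
    unfolding lorentzian_at_def
  proof (intro exI conjI allI)
    fix i j
    show "tvec_of A c p (e i) \<in> tangent_space A p" using tvec_of_mem[OF c] .
    show "g p (tvec_of A c p (e i)) (tvec_of A c p (e j)) = (if i \<noteq> j then 0 else if i = k then -1 else 1)"
      using bilinear_components[of p g, OF B c tvec_of_mem[OF c] tvec_of_mem[OF c]] c e
      unfolding lorentz_basis_def by simp
  qed
qed

subsection \<open>Smoothness in a single chart\<close>

text \<open>Smoothness on the manifold is required in every chart of the atlas, whereas the fields
  below are constructed in a single one.\<close>

lemma smooth_on_change_chart: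
  assumes c: "c \<in> A" "c' \<in> A" and U: "openin X U"
    and h: "smooth_on (coord c ` (cdom c \<inter> cdom c' \<inter> U)) h"
  shows "smooth_on (coord c' ` (cdom c \<inter> cdom c' \<inter> U)) (\<lambda>x. h (transition c' c x))"
proof (rule smooth_on_compose[OF _ _ _ h])
  let ?W = "cdom c \<inter> cdom c' \<inter> U"
  have W: "openin X ?W" using openin_cdom c U by blast
  show "open (coord c' ` ?W)"
    using open_coord_image[OF c(2) W] by (simp add: Int_absorb1 Int_assoc Int_left_commute)
  show "open (coord c ` ?W)"
    using open_coord_image[OF c(1) W] by (simp add: Int_absorb1 Int_assoc)
  show "transition c' c ` coord c' ` ?W \<subseteq> coord c ` ?W"
    using c transition_coord by auto
  show "smooth_on (coord c' ` ?W) (transition c' c)"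
    by (rule smooth_on_subset[OF smooth_transition[OF c(2,1)]]) auto
qed

lemma smooth_funI:
  assumes c: "c \<in> A" and U: "openin X U" "U \<subseteq> cdom c" and h: "smooth_on (coord c ` U) h"
    and f: "\<And>p. p \<in> U \<Longrightarrow> f p = h (coord c p)"
  shows "smooth_fun A U f"
  unfolding smooth_fun_def
proof
  fix c' assume c': "c' \<in> A"
  have eq: "cdom c \<inter> cdom c' \<inter> U = cdom c' \<inter> U" using U(2) by auto
  have "smooth_on (coord c ` (cdom c \<inter> cdom c' \<inter> U)) h"
    by (rule smooth_on_subset[OF h]) auto
  from smooth_on_change_chart[OF c c' U(1) this]
  have "smooth_on (coord c' ` (cdom c' \<inter> U)) (\<lambda>x. h (transition c' c x))" unfolding eq .
  then show "smooth_on (coord c' ` (cdom c' \<inter> U)) (f \<circ> chart_inv c')"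
  proof (rule smooth_on_cong[OF open_coord_image[OF c' U(1)], rotated])
    fix x assume "x \<in> coord c' ` (cdom c' \<inter> U)"
    then show "h (transition c' c x) = (f \<circ> chart_inv c') x"
      using c' f transition_coord[OF c'] by auto
  qed
qed

lemma smooth_vector_fieldI:
  assumes c: "c \<in> A" and U: "openin X U" "U \<subseteq> cdom c" and h: "smooth_on (coord c ` U) h"
  shows "smooth_vector_field A U (\<lambda>p. tvec_of A c p (h (coord c p)))"
  unfolding smooth_vector_field_def
proof (intro conjI ballI)
  have cU: "c \<in> charts_at A p" if "p \<in> U" for p using that c U(2) unfolding charts_at_def by auto
  show "tvec_of A c p (h (coord c p)) \<in> tangent_space A p" if "p \<in> U" for p
    using tvec_of_mem[OF cU[OF that]] .
  fix c' assume c': "c' \<in> A"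
  have W: "openin X (cdom c \<inter> cdom c' \<inter> U)" using openin_cdom c c' U by blast
  have eq: "cdom c \<inter> cdom c' \<inter> U = cdom c' \<inter> U" using U(2) by auto
  have op: "open (coord c ` (cdom c \<inter> cdom c' \<inter> U))"
    using open_coord_image[OF c W] by (simp add: Int_absorb1 Int_assoc)
  have "smooth_on (coord c ` (cdom c \<inter> cdom c' \<inter> U))
      (\<lambda>y. frechet_derivative (transition c c') (at y) (h y))"
    by (rule smooth_on_frechet_derivative_apply[OF op])
      (auto intro: smooth_on_subset[OF smooth_transition[OF c c']] smooth_on_subset[OF h])
  from smooth_on_change_chart[OF c c' U(1) this]
  have "smooth_on (coord c' ` (cdom c' \<inter> U))
      (\<lambda>x. frechet_derivative (transition c c') (at (transition c' c x)) (h (transition c' c x)))"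
    unfolding eq .
  then show "smooth_on (coord c' ` (cdom c' \<inter> U))
      (\<lambda>x. tvec_of A c (chart_inv c' x) (h (coord c (chart_inv c' x))) c')"
  proof (rule smooth_on_cong[OF open_coord_image[OF c' U(1)], rotated])
    fix x assume "x \<in> coord c' ` (cdom c' \<inter> U)"
    then obtain p where p: "x = coord c' p" "p \<in> cdom c'" "p \<in> U" by blast
    then have "c' \<in> charts_at A p" using c' unfolding charts_at_def by simp
    then show "frechet_derivative (transition c c') (at (transition c' c x)) (h (transition c' c x)) =
        tvec_of A c (chart_inv c' x) (h (coord c (chart_inv c' x))) c'"
      using p c' transition_coord[OF c'] by (simp add: tvec_of_def)
  qed
qed

subsection \<open>Differentials and curves\<close>

text \<open>\<open>differential\<close> computes in a chart selected by \<open>SOME\<close>. The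
  chain rule through the transition map, combined with the transformation law of \<open>w\<close>,
  moves the computation to any chart.\<close>

lemma differential_eq:
  assumes c: "c \<in> charts_at A q" and F: "((f \<circ> chart_inv c) has_derivative F') (at (coord c q))"
    and w: "w \<in> tangent_space A q"
  shows "differential A f q w = F' (w c)"
proof -
  define c0 where "c0 = (SOME c. c \<in> charts_at A q)"
  have c0: "c0 \<in> charts_at A q" unfolding c0_def using c by (rule someI)
  have F: "((f \<circ> chart_inv c) has_derivative F') (at (transition c0 c (coord c0 q)))"
    using F transition_coord[OF charts_atD[OF c0]] by simp
  from diff_chain_at[OF transition_has_derivative[OF c0 c] F]
  have "((f \<circ> chart_inv c0) has_derivative F' \<circ> frechet_derivative (transition c0 c) (at (coord c0 q))) (at (coord c0 q))"
  proof (rule has_derivative_transform_within_open)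
    show "open (coord c0 ` (cdom c0 \<inter> cdom c))"
      by (rule open_coord_image[OF charts_atD(1)[OF c0] openin_cdom[OF charts_atD(1)[OF c]]])
    show "coord c0 q \<in> coord c0 ` (cdom c0 \<inter> cdom c)" using charts_atD(2)[OF c0] charts_atD(2)[OF c] by blast
    fix x assume "x \<in> coord c0 ` (cdom c0 \<inter> cdom c)"
    then show "(f \<circ> chart_inv c \<circ> transition c0 c) x = (f \<circ> chart_inv c0) x"
      using charts_atD(1)[OF c0] charts_atD(1)[OF c] transition_coord by auto
  qed
  from frechet_derivative_at[OF this]
  show ?thesis
    unfolding differential_def Let_def c0_def[symmetric] tangent_transition[OF w c0 c]
    by (simp add: fun_eq_iff)
qed

lemma differential_nonzero_iff:
  assumes c: "c \<in> charts_at A q" and F: "((f \<circ> chart_inv c) has_derivative F') (at (coord c q))"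
  shows "differential_nonzero A f q \<longleftrightarrow> (\<exists>x. F' x \<noteq> 0)"
  unfolding differential_nonzero_def using differential_eq[OF assms] tvec_of_mem[OF c] tvec_of_self[OF c]
  by metis

lemma smooth_curve_chart_inv:
  assumes c: "c \<in> A" and \<sigma>: "smooth_on {-e<..<e} \<sigma>" "\<sigma> ` {-e<..<e} \<subseteq> coord c ` cdom c"
  shows "smooth_curve X A e (chart_inv c \<circ> \<sigma>)"
  unfolding smooth_curve_def
proof (intro conjI ballI)
  let ?I = "{-e<..<e}"
  have cont\<sigma>: "continuous_on ?I \<sigma>" using smooth_on_continuous[OF \<sigma>(1)] .
  then have "continuous_map (top_of_set ?I) (top_of_set (coord c ` cdom c)) \<sigma>"
    using \<sigma>(2) by (simp add: image_subset_iff_funcset continuous_map_in_subtopology)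
  then show cont: "continuous_map (top_of_set ?I) X (chart_inv c \<circ> \<sigma>)"
    by (rule continuous_map_compose[OF _ continuous_map_chart_inv[OF c]])
  fix c' assume c': "c' \<in> A"
  let ?T = "coord c ` (cdom c \<inter> cdom c')"
  have T: "open ?T" using open_coord_image[OF c openin_cdom[OF c']] .
  have J: "{t \<in> ?I. (chart_inv c \<circ> \<sigma>) t \<in> cdom c'} = ?I \<inter> \<sigma> -` ?T"
  proof (intro equalityI subsetI)
    fix t assume t: "t \<in> {t \<in> ?I. (chart_inv c \<circ> \<sigma>) t \<in> cdom c'}"
    then obtain p where "\<sigma> t = coord c p" "p \<in> cdom c" using \<sigma>(2) by blast
    then show "t \<in> ?I \<inter> \<sigma> -` ?T" using t c by auto
  qed (use c in auto)
  have op: "open (?I \<inter> \<sigma> -` ?T)"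
    by (rule continuous_open_preimage[OF cont\<sigma> _ T]) simp
  have "smooth_on (?I \<inter> \<sigma> -` ?T) (\<lambda>t. transition c c' (\<sigma> t))"
    by (rule smooth_on_compose[OF op T _ smooth_transition[OF c c'] smooth_on_subset[OF \<sigma>(1)]]) auto
  then show "smooth_on {t \<in> ?I. (chart_inv c \<circ> \<sigma>) t \<in> cdom c'} (coord c' \<circ> (chart_inv c \<circ> \<sigma>))"
    unfolding J by (simp add: transition_def o_def)
qed

text \<open>Along a curve in \<open>S\<close> the function is constant near time 0, so the chain
  rule annihilates its velocity.\<close>

lemma tangent_space_of_kernel:
  assumes v: "v \<in> tangent_space_of X A S q" and c: "c \<in> charts_at A q"
    and F: "((f \<circ> chart_inv c) has_derivative F') (at (coord c q))"
    and const: "\<And>p. p \<in> S \<Longrightarrow> p \<in> cdom c \<Longrightarrow> f p = k"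
  shows "F' (v c) = 0"
proof -
  obtain e \<gamma> where e: "e > 0" "smooth_curve X A e \<gamma>" "\<gamma> 0 = q" "\<gamma> ` {-e<..<e} \<subseteq> S"
    and d: "((coord c \<circ> \<gamma>) has_vector_derivative v c) (at 0)"
    using v c unfolding tangent_space_of_def by blast
  have F: "((f \<circ> chart_inv c) has_derivative F') (at ((coord c \<circ> \<gamma>) 0))" using F e(3) by simp
  have d1: "((f \<circ> chart_inv c \<circ> (coord c \<circ> \<gamma>)) has_derivative (F' \<circ> (\<lambda>r. r *\<^sub>R v c))) (at 0)"
    using diff_chain_at[OF d[unfolded has_vector_derivative_def] F] .
  \<comment> \<open>The curve may leave the chart; by continuity it stays inside for times in the
    open set \<open>J\<close> around 0.\<close>
  define J where "J = {t \<in> {-e<..<e}. \<gamma> t \<in> cdom c}"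
  have "openin (top_of_set {-e<..<e}) {t \<in> topspace (top_of_set {-e<..<e}). \<gamma> t \<in> cdom c}"
    using e(2) openin_cdom[OF charts_atD(1)[OF c]] unfolding smooth_curve_def
    by (intro openin_continuous_map_preimage) auto
  then have J: "open J" unfolding J_def using openin_open_trans by fastforce
  have "((\<lambda>_. k) has_derivative (F' \<circ> (\<lambda>r. r *\<^sub>R v c))) (at 0)"
  proof (rule has_derivative_transform_within_open[OF d1 J])
    show "0 \<in> J" using e charts_atD(2)[OF c] unfolding J_def by auto
    fix t assume "t \<in> J"
    then show "(f \<circ> chart_inv c \<circ> (coord c \<circ> \<gamma>)) t = k"
      using const[of "\<gamma> t"] e(4) charts_atD(1)[OF c] unfolding J_def by (simp add: image_subset_iff)
  qed
  moreover have "((\<lambda>_. k) has_derivative (\<lambda>_. 0)) (at (0::real))" by simp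
  ultimately have "F' \<circ> (\<lambda>r. r *\<^sub>R v c) = (\<lambda>_. 0)" by (rule has_derivative_unique)
  from fun_cong[OF this, of 1] show ?thesis by simp
qed

text \<open>The curve from \<open>smooth_level_curve\<close> is carried to the manifold by the
  inverse chart; its velocities in other charts follow from the transformation law of
  \<open>v\<close>.\<close>

lemma level_set_tangent:
  fixes f :: "'a \<Rightarrow> real"
  assumes c: "c \<in> charts_at A q" and U: "openin X U" "q \<in> U"
    and f: "smooth_on (coord c ` (cdom c \<inter> U)) (f \<circ> chart_inv c)"
    and b: "frechet_derivative (f \<circ> chart_inv c) (at (coord c q)) b \<noteq> 0"
    and v: "v \<in> tangent_space A q" "frechet_derivative (f \<circ> chart_inv c) (at (coord c q)) (v c) = 0"
  shows "v \<in> tangent_space_of X A {p \<in> U. f p = f q} q"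
proof -
  note cA = charts_atD(1)[OF c] and qc = charts_atD(2)[OF c]
  let ?\<Omega> = "coord c ` (cdom c \<inter> U)"
  have \<Omega>: "open ?\<Omega>" "coord c q \<in> ?\<Omega>" using open_coord_image[OF cA U(1)] qc U(2) by auto
  obtain e \<sigma> where e: "e > 0" "smooth_on {-e<..<e} \<sigma>" "\<sigma> 0 = coord c q"
    and \<sigma>: "\<And>t. t \<in> {-e<..<e} \<Longrightarrow> \<sigma> t \<in> ?\<Omega> \<and> (f \<circ> chart_inv c) (\<sigma> t) = (f \<circ> chart_inv c) (coord c q)"
    and d: "(\<sigma> has_vector_derivative v c) (at 0)"
    using smooth_level_curve[OF \<Omega> f b v(2)] by metis
  define \<gamma> where "\<gamma> = chart_inv c \<circ> \<sigma>"
  have \<gamma>0: "\<gamma> 0 = q" unfolding \<gamma>_def using e(3) cA qc by simp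
  have "smooth_curve X A e \<gamma>"
    unfolding \<gamma>_def using \<sigma> by (intro smooth_curve_chart_inv[OF cA e(2)]) blast
  moreover have "\<gamma> ` {-e<..<e} \<subseteq> {p \<in> U. f p = f q}"
    using \<sigma> chart_inv_mem[OF cA, of "cdom c \<inter> U"] cA qc unfolding \<gamma>_def by auto
  moreover have "((coord c' \<circ> \<gamma>) has_vector_derivative v c') (at 0)" if c': "c' \<in> charts_at A q" for c'
  proof -
    have d': "(transition c c' has_derivative frechet_derivative (transition c c') (at (coord c q))) (at (\<sigma> 0))"
      unfolding e(3) by (rule transition_has_derivative[OF c c'])
    have "((transition c c' \<circ> \<sigma>) has_derivative
        (frechet_derivative (transition c c') (at (coord c q)) \<circ> (\<lambda>r. r *\<^sub>R v c))) (at 0)"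
      by (rule diff_chain_at[OF d[unfolded has_vector_derivative_def] d'])
    moreover have "frechet_derivative (transition c c') (at (coord c q)) \<circ> (\<lambda>r. r *\<^sub>R v c) = (\<lambda>r. r *\<^sub>R v c')"
      using linear_transition_derivative[OF c c'] tangent_transition[OF v(1) c c']
      by (simp add: fun_eq_iff linear_cmul)
    moreover have "transition c c' \<circ> \<sigma> = coord c' \<circ> \<gamma>"
      unfolding transition_def \<gamma>_def by (simp add: o_assoc)
    ultimately show ?thesis unfolding has_vector_derivative_def by simp
  qed
  ultimately show ?thesis
    unfolding tangent_space_of_def using v(1) e(1) \<gamma>0 by blast
qed

subsection \<open>The transformation prescription\<close>

lemma degeneracy_locus_iff:
  assumes g: "symmetric_tensor_field A (topspace X) gt" and c: "c \<in> charts_at A p"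
  shows "p \<in> degeneracy_locus X A gt \<longleftrightarrow> det (components A gt c p) = 0"
proof -
  have p: "p \<in> topspace X" using charts_atD[OF c] openin_subset[OF openin_cdom] by blast
  then have "symmetric_bilinear A p (gt p)" using g unfolding symmetric_tensor_field_def by blast
  from radical_trivial_iff[of p gt, OF this c] show ?thesis
    using p unfolding degeneracy_locus_def by blast
qed

lemma line_element_fieldE:
  assumes "line_element_field X A U L" "p \<in> U"
  obtains v where "L p = {v, tv_minus v}" "v \<in> tangent_space A p"
proof -
  obtain W V where "p \<in> W" "smooth_vector_field A W V" "\<forall>q\<in>W. L q = {V q, tv_minus (V q)}"
    using assms unfolding line_element_field_def by (metis (no_types, lifting))
  then show thesis using that[of "V p"] unfolding smooth_vector_field_def by simp
qed

text \<open>Puts the prescription into the matrix form of a rank one perturbation, for which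
  determinant and kernel are computable.\<close>

lemma prescription_components:
  assumes tp: "transformation_prescription X A U gt g L f" and p: "p \<in> U" "c \<in> charts_at A p"
    and v: "v \<in> L p" "v \<in> tangent_space A p"
  defines "G \<equiv> components A g c p"
  shows "components A gt c p = (\<chi> i j. G $ i $ j + f p * ((G *v v c) $ i * (G *v v c) $ j))"
    and "v c \<bullet> (G *v v c) = -1" and "transpose G = G" and "det G < 0"
proof -
  have B: "symmetric_bilinear A p (g p)" and Lz: "lorentzian_at A g p"
    using tp p(1) unfolding transformation_prescription_def lorentzian_metric_def symmetric_tensor_field_def
    by auto
  show sym: "transpose G = G" unfolding G_def using transpose_components[of p g, OF B p(2)] .
  have "g p v v = -1" using tp p(1) v(1) unfolding transformation_prescription_def by blast
  then show "v c \<bullet> (G *v v c) = -1"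
    unfolding G_def using bilinear_components[of p g, OF B p(2) v(2,2)] by simp
  show "det G < 0"
    using Lz lorentzian_at_iff[of p g, OF B p(2)] lorentz_basis_det(1) unfolding G_def by blast
  have t: "coord_vec A c p i \<in> tangent_space A p" for i
    unfolding coord_vec_eq_tvec_of by (rule tvec_of_mem[OF p(2)])
  have gv: "g p v (coord_vec A c p i) = (G *v v c) $ i" for i
    using bilinear_components[of p g, OF B p(2) v(2) t, of i] symmetric_matrix_inner[OF sym, of "v c" "axis i 1"] p(2)
    unfolding G_def coord_vec_eq_tvec_of by (simp add: cart_eq_inner_axis inner_commute)
  have "gt p (coord_vec A c p i) (coord_vec A c p j) =
      g p (coord_vec A c p i) (coord_vec A c p j) + f p * ((G *v v c) $ i * (G *v v c) $ j)" for i j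
    using tp p(1) v(1) t gv unfolding transformation_prescription_def flat_def by simp
  then show "components A gt c p = (\<chi> i j. G $ i $ j + f p * ((G *v v c) $ i * (G *v v c) $ j))"
    unfolding G_def by (simp add: components_def)
qed

section \<open>From the prescription to transversality, on an arbitrary open set\<close>

lemma prescription_imp_transverse:
  assumes gt: "symmetric_tensor_field A (topspace X) gt" and U: "openin X U"
    and tp: "transformation_prescription X A U gt g L f"
    and H: "{q \<in> U. f q = 1} = degeneracy_locus X A gt \<inter> U"
    and df: "\<And>q v. q \<in> U \<Longrightarrow> f q = 1 \<Longrightarrow> v \<in> L q \<Longrightarrow> differential A f q v \<noteq> 0"
  shows "transverse_type_changing X A U gt \<and> transverse_radical X A U gt"
proof -
  have Lf: "line_element_field X A U L" and sf: "smooth_fun A U f"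
    and lm: "symmetric_tensor_field A U g"
    using tp unfolding transformation_prescription_def lorentzian_metric_def by auto
  have smf: "smooth_on (coord c ` (cdom c \<inter> U)) (f \<circ> chart_inv c)" if "c \<in> A" for c
    using sf that unfolding smooth_fun_def by blast
  have derf: "((f \<circ> chart_inv c) has_derivative frechet_derivative (f \<circ> chart_inv c) (at (coord c q))) (at (coord c q))"
    if "q \<in> U" "c \<in> charts_at A q" for c q
    using smooth_on_has_derivative[OF smf[OF charts_atD(1)[OF that(2)]]] that charts_atD(2)[OF that(2)] by blast
  have det: "det (components A gt c p) = det (components A g c p) * (1 - f p)"
    if p: "p \<in> U" "c \<in> charts_at A p" for p c
  proof -
    obtain v where v: "v \<in> L p" "v \<in> tangent_space A p"
      using line_element_fieldE[OF Lf p(1)] by blast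
    note P = prescription_components[OF tp p v]
    show ?thesis unfolding P(1) det_add_flat[OF P(3)] P(2) by simp
  qed
  have "transverse_type_changing X A U gt"
    unfolding transverse_type_changing_def
  proof (intro ballI)
    fix q c assume q: "q \<in> degeneracy_locus X A gt \<inter> U" and c: "c \<in> charts_at A q"
    note cA = charts_atD(1)[OF c] and qc = charts_atD(2)[OF c]
    have qU: "q \<in> U" "f q = 1" using q H by auto
    obtain v where v: "v \<in> L q" "v \<in> tangent_space A q"
      using line_element_fieldE[OF Lf qU(1)] by blast
    define F where "F = f \<circ> chart_inv c"
    define F' where "F' = frechet_derivative F (at (coord c q))"
    define G where "G = (\<lambda>x. det (components A g c (chart_inv c x)))"
    let ?\<Omega> = "coord c ` (cdom c \<inter> U)"
    have \<Omega>: "open ?\<Omega>" "coord c q \<in> ?\<Omega>" using open_coord_image[OF cA U] qc qU(1) by auto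
    have F: "(F has_derivative F') (at (coord c q))"
      unfolding F_def F'_def using derf[OF qU(1) c] .
    have "smooth_on ?\<Omega> G"
      unfolding G_def using lm cA unfolding symmetric_tensor_field_def by (intro smooth_on_det[OF \<Omega>(1)]) blast
    then have G: "(G has_derivative frechet_derivative G (at (coord c q))) (at (coord c q))"
      using smooth_on_has_derivative \<Omega>(2) by blast
    have F0: "F (coord c q) = 1" unfolding F_def using qU(2) cA qc by simp
    \<comment> \<open>The term of the product rule containing the derivative of \<open>G\<close> is
      multiplied by \<open>1 - F\<close>, which vanishes at this point.\<close>
    have "((\<lambda>x. G x * (1 - F x)) has_derivative
        (\<lambda>h. G (coord c q) * (- F' h))) (at (coord c q))"
      using F0 by (auto intro!: derivative_eq_intros G F)
    then have D: "(((\<lambda>p. det (components A gt c p)) \<circ> chart_inv c) has_derivative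
        (\<lambda>h. G (coord c q) * (- F' h))) (at (coord c q))"
    proof (rule has_derivative_transform_within_open[OF _ \<Omega>])
      fix x assume "x \<in> ?\<Omega>"
      then obtain p where p: "x = coord c p" "p \<in> cdom c" "p \<in> U" by blast
      then have "c \<in> charts_at A p" using cA unfolding charts_at_def by simp
      then show "G x * (1 - F x) = ((\<lambda>p. det (components A gt c p)) \<circ> chart_inv c) x"
        using det[OF p(3)] p cA unfolding G_def F_def by simp
    qed
    have "F' (v c) \<noteq> 0"
      using df[OF qU v(1)] differential_eq[OF c F[unfolded F_def] v(2)] by simp
    moreover have "G (coord c q) \<noteq> 0"
      unfolding G_def using prescription_components(4)[OF tp qU(1) c v] cA qc by simp
    ultimately show "differential_nonzero A (\<lambda>p. det (components A gt c p)) q"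
      unfolding differential_nonzero_iff[OF c D] by (intro exI[of _ "v c"]) simp
  qed
  moreover have "transverse_radical X A U gt"
    unfolding transverse_radical_def
  proof (intro ballI)
    fix q w assume q: "q \<in> degeneracy_locus X A gt \<inter> U" and w: "w \<in> tangent_space A q"
    have qU: "q \<in> U" "f q = 1" using q H by auto
    have qX: "q \<in> topspace X" using openin_subset[OF U] qU(1) by blast
    obtain c where c: "c \<in> charts_at A q" using chart_around[OF qX] by blast
    obtain v where v: "v \<in> L q" "v \<in> tangent_space A q"
      using line_element_fieldE[OF Lf qU(1)] by blast
    define F' where "F' = frechet_derivative (f \<circ> chart_inv c) (at (coord c q))"
    have F': "((f \<circ> chart_inv c) has_derivative F') (at (coord c q))"
      unfolding F'_def using derf[OF qU(1) c] .
    have lin: "linear F'" using F' has_derivative_linear by blast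
    have Fv: "F' (v c) \<noteq> 0"
      using df[OF qU v(1)] differential_eq[OF c F' v(2)] by simp
    define G where "G = components A g c q"
    note P = prescription_components[OF tp qU(1) c v, folded G_def, unfolded qU(2)]
    have Bt: "symmetric_bilinear A q (gt q)"
      using gt qX unfolding symmetric_tensor_field_def by blast
    \<comment> \<open>At \<open>f = 1\<close> the matrix of \<open>gt\<close> factors through the
      injective \<open>G\<close>. A kernel vector \<open>x\<close> is therefore a multiple of
      \<open>v c\<close>, and every multiple occurs because \<open>v\<close> has square -1.\<close>
    have ker: "components A gt c q *v x = G *v (x + (x \<bullet> (G *v v c)) *\<^sub>R v c)" for x
      unfolding P(1) add_rank_one_mult
      by (simp add: matrix_vector_right_distrib matrix_vector_mult_scaleR)
    have rad: "u \<in> radical A gt q \<longleftrightarrow> (\<exists>a. u = tv_scale a v)" for u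
    proof
      assume "u \<in> radical A gt q"
      then have u: "u \<in> tangent_space A q" "G *v (u c + (u c \<bullet> (G *v v c)) *\<^sub>R v c) = 0"
        using radical_iff[of q gt, OF Bt c] ker by auto
      have "inj ((*v) G)" using P(4) by (intro inj_matrix_vector_mult) (simp add: invertible_det_nz)
      from injD[OF this, of "u c + (u c \<bullet> (G *v v c)) *\<^sub>R v c" 0]
      have "u c = (- (u c \<bullet> (G *v v c))) *\<^sub>R v c"
        using u(2) by (simp add: add_eq_0_iff2)
      then have "u c = tv_scale (- (u c \<bullet> (G *v v c))) v c" by (simp add: tv_scale_def)
      then show "\<exists>a. u = tv_scale a v"
        using tangent_eqI[OF u(1) tangent_space_scale[OF v(2) c] c] by blast
    next
      assume "\<exists>a. u = tv_scale a v"
      then obtain a where a: "u = tv_scale a v" by blast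
      have "u c + (u c \<bullet> (G *v v c)) *\<^sub>R v c = 0"
        unfolding a tv_scale_def using P(2) by simp
      then show "u \<in> radical A gt q"
        unfolding radical_iff[of q gt, OF Bt c] ker
        using tangent_space_scale[OF v(2) c] a by simp
    qed
    have Seq: "{p \<in> U. f p = f q} = degeneracy_locus X A gt \<inter> U" using H qU(2) by simp
    \<comment> \<open>The coefficient for which \<open>w - a v\<close> lies in the kernel of
      \<open>df\<close>; the denominator is nonzero by \<open>df(V) \<noteq> 0\<close>.\<close>
    define a where "a = F' (w c) / F' (v c)"
    let ?u = "tv_scale a v" and ?v = "tv_add w (tv_scale (- a) v)"
    show "\<exists>!(u, v). u \<in> radical A gt q \<and>
        v \<in> tangent_space_of X A (degeneracy_locus X A gt \<inter> U) q \<and> w = tv_add u v"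
    proof (rule ex1I[of _ "(?u, ?v)"])
      have vt: "?v \<in> tangent_space A q"
        by (intro tangent_space_add[OF w _ c] tangent_space_scale[OF v(2) c])
      have "F' (?v c) = 0"
        using Fv lin by (simp add: a_def tv_add_def tv_scale_def linear_diff linear_cmul)
      then have "?v \<in> tangent_space_of X A (degeneracy_locus X A gt \<inter> U) q"
        using level_set_tangent[OF c U qU(1) smf[OF charts_atD(1)[OF c]] _ vt, of "v c"] Fv
        unfolding F'_def Seq by blast
      then show "case (?u, ?v) of (u, v) \<Rightarrow> u \<in> radical A gt q \<and>
          v \<in> tangent_space_of X A (degeneracy_locus X A gt \<inter> U) q \<and> w = tv_add u v"
        unfolding prod.case rad by (auto simp: tv_add_def tv_scale_def)
    next
      fix z assume "case z of (u, v) \<Rightarrow> u \<in> radical A gt q \<and>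
          v \<in> tangent_space_of X A (degeneracy_locus X A gt \<inter> U) q \<and> w = tv_add u v"
      then obtain u' v' where z: "z = (u', v')" and u': "u' \<in> radical A gt q"
        and v': "v' \<in> tangent_space_of X A (degeneracy_locus X A gt \<inter> U) q" and w': "w = tv_add u' v'"
        by (cases z) auto
      obtain a' where a': "u' = tv_scale a' v" using u' rad by blast
      \<comment> \<open>Uniqueness: \<open>f\<close> is constant on the degeneracy locus in
        \<open>U\<close>, so applying \<open>df\<close> to the decomposition determines the
        coefficient of \<open>v\<close>.\<close>
      have "F' (v' c) = 0"
        using tangent_space_of_kernel[OF v' c F', of 1] H by blast
      then have "F' (w c) = a' * F' (v c)"
        unfolding w' a' using lin by (simp add: tv_add_def tv_scale_def linear_add linear_cmul)
      then have "a' = a" using Fv unfolding a_def by simp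
      then show "z = (?u, ?v)"
        unfolding z a' w' by (simp add: tv_add_def tv_scale_def)
    qed
  qed
  ultimately show ?thesis by blast
qed

section \<open>From transversality to the prescription, near a given point\<close>

lemma signature_type_changing_components:
  assumes st: "signature_type_changing X A gt" and c: "c \<in> charts_at A p"
    and d: "det (components A gt c p) \<noteq> 0"
  shows "pos_def (components A gt c p) \<or> (\<exists>e k. lorentz_basis (components A gt c p) e k)"
proof -
  have gt: "symmetric_tensor_field A (topspace X) gt"
    using st unfolding signature_type_changing_def by blast
  have p: "p \<in> topspace X" using charts_atD[OF c] openin_subset[OF openin_cdom] by blast
  have B: "symmetric_bilinear A p (gt p)"
    using gt p unfolding symmetric_tensor_field_def by blast
  let ?Y = "subtopology X (topspace X - degeneracy_locus X A gt)"
  have "\<exists>R\<in>connected_components_of ?Y. (\<forall>q\<in>R. positive_definite_at A gt q) \<and>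
      (\<forall>C\<in>connected_components_of ?Y - {R}. \<forall>q\<in>C. lorentzian_at A gt q)"
    using st unfolding signature_type_changing_def Let_def by (elim conjE)
  then obtain R where R: "\<forall>q\<in>R. positive_definite_at A gt q"
    "\<forall>C\<in>connected_components_of ?Y - {R}. \<forall>q\<in>C. lorentzian_at A gt q"
    by (elim bexE conjE)
  have "p \<in> topspace ?Y"
    using p d degeneracy_locus_iff[OF gt c] by simp
  \<comment> \<open>The point lies in some connected component of the nondegenerate set, either the
    Riemannian \<open>R\<close> or a Lorentzian one.\<close>
  then obtain C where "C \<in> connected_components_of ?Y" "p \<in> C"
    using Union_connected_components_of[of ?Y] by blast
  then have "positive_definite_at A gt p \<or> lorentzian_at A gt p"
    using R by (cases "C = R") auto
  then show ?thesis
    using pos_def_components[of p gt, OF B c] lorentzian_at_iff[of p gt, OF B c] by blast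
qed

lemma radical_adjugate:
  assumes B: "symmetric_bilinear A q (gt q)" and c: "c \<in> charts_at A q"
    and d: "det (components A gt c q) = 0" and V: "adjugate_mv (components A gt c q) b \<noteq> 0"
    and u: "u \<in> radical A gt q"
  obtains r where "u c = r *\<^sub>R adjugate_mv (components A gt c q) b"
proof -
  have "components A gt c q *v u c = 0"
    using u radical_iff[of q gt, OF B c] by blast
  then show thesis using adjugate_mv_spans_kernel[OF V d] that by metis
qed

lemma transverse_imp_prescription:
  assumes st: "signature_type_changing X A gt" and p0: "p0 \<in> topspace X"
    and tt: "transverse_type_changing X A (topspace X) gt"
    and tr: "transverse_radical X A (topspace X) gt"
  shows "\<exists>U. openin X U \<and> p0 \<in> U \<and> (\<exists>g L f. transformation_prescription X A U gt g L f \<and>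
      {q \<in> U. f q = 1} = degeneracy_locus X A gt \<inter> U \<and>
      (\<forall>q \<in> {q \<in> U. f q = 1}.
         differential_nonzero A f q \<and> (\<forall>v\<in>L q. differential A f q v \<noteq> 0)))"
proof -
  have gt: "symmetric_tensor_field A (topspace X) gt"
    using st unfolding signature_type_changing_def by blast
  obtain c where c0: "c \<in> charts_at A p0" using chart_around[OF p0] by blast
  note cA = charts_atD(1)[OF c0] and p0c = charts_atD(2)[OF c0]
  have domX: "cdom c' \<subseteq> topspace X" if "c' \<in> A" for c' using openin_subset[OF openin_cdom[OF that]] .
  define S where "S = coord c ` cdom c"
  define M where "M = (\<lambda>x. components A gt c (chart_inv c x))"
  define x0 where "x0 = coord c p0"
  have S: "open S" "x0 \<in> S" unfolding S_def x0_def using open_coord_image_cdom[OF cA] p0c by auto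
  have Bt: "symmetric_bilinear A p (gt p)" if "p \<in> topspace X" for p
    using gt that unfolding symmetric_tensor_field_def by blast
  have smM: "smooth_on S (\<lambda>x. M x $ i $ j)" for i j
    using gt cA domX[OF cA] unfolding symmetric_tensor_field_def S_def M_def by (metis Int_absorb2)
  have cS: "chart_inv c x \<in> cdom c" "c \<in> charts_at A (chart_inv c x)" "chart_inv c x \<in> topspace X"
    if "x \<in> S" for x
    using that cA domX[OF cA] unfolding S_def charts_at_def by auto
  have symM: "transpose (M x) = M x" if "x \<in> S" for x
    unfolding M_def using transpose_components[of "chart_inv c x" gt] Bt cS[OF that] by blast
  have type: "pos_def (M x) \<or> (\<exists>e k. lorentz_basis (M x) e k)" if "x \<in> S" "det (M x) \<noteq> 0" for x
    using signature_type_changing_components[OF st cS(2)[OF that(1)]] that(2) unfolding M_def by blast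
  have smD: "smooth_on S (\<lambda>x. det (M x))" by (rule smooth_on_det[OF S(1) smM])
  have DM: "((\<lambda>p. det (components A gt c p)) \<circ> chart_inv c) = (\<lambda>x. det (M x))"
    unfolding M_def by auto
  have derD: "(((\<lambda>p. det (components A gt c p)) \<circ> chart_inv c) has_derivative
      frechet_derivative (\<lambda>x. det (M x)) (at x)) (at x)" if "x \<in> S" for x
    unfolding DM using smooth_on_has_derivative[OF smD that] .
  have Dnz: "\<exists>h. frechet_derivative (\<lambda>x. det (M x)) (at x) h \<noteq> 0" if x: "x \<in> S" "det (M x) = 0" for x
  proof -
    let ?q = "chart_inv c x"
    have cx: "coord c ?q = x" using x(1) unfolding S_def by (rule coord_chart_inv)
    have "?q \<in> degeneracy_locus X A gt"
      using degeneracy_locus_iff[OF gt cS(2)[OF x(1)]] x(2) unfolding M_def by blast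
    then have "differential_nonzero A (\<lambda>p. det (components A gt c p)) ?q"
      using tt cS[OF x(1)] unfolding transverse_type_changing_def by blast
    then show ?thesis
      using differential_nonzero_iff[OF cS(2)[OF x(1)], unfolded cx, OF derD[OF x(1)]] by blast
  qed
  obtain b where b: "b \<noteq> 0" "b \<bullet> adjugate_mv (M x0) b > 0"
    and bpos: "\<And>w. b \<bullet> w = 0 \<Longrightarrow> w \<noteq> 0 \<Longrightarrow> w \<bullet> (M x0 *v w) > 0"
    using lorentzian_prescription_covector[OF S smM symM type] Dnz[OF S(2)] by metis
  define V where "V = (\<lambda>x. adjugate_mv (M x) b)"
  define \<beta> where "\<beta> = (\<lambda>x. b \<bullet> V x)"
  have smV: "smooth_on S V" unfolding V_def by (rule smooth_on_adjugate_mv[OF S(1) smM])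
  have sm\<beta>: "smooth_on S \<beta>" unfolding \<beta>_def by (intro smooth_on_inner smooth_on_const smV S(1))
  have MV: "M x *v V x = det (M x) *\<^sub>R b" for x unfolding V_def by (rule matrix_adjugate_mv)
  have cont: "(q \<longlongrightarrow> q x0) (nhds x0)" if "smooth_on S q" for q :: "real^'n \<Rightarrow> real"
  proof -
    have "isCont q x0"
      using smooth_on_continuous[OF that] S continuous_on_eq_continuous_at by blast
    then show ?thesis by (simp add: continuous_at tendsto_at_iff_tendsto_nhds)
  qed
  \<comment> \<open>Both inequalities arranged at \<open>x0\<close> persist on a neighbourhood
    \<open>T\<close>, on which all fields are then defined.\<close>
  have "\<forall>\<^sub>F x in nhds x0. \<beta> x > 0"
    using order_tendstoD(1)[OF cont[OF sm\<beta>], of 0] b(2) unfolding \<beta>_def V_def by blast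
  moreover have "\<forall>\<^sub>F x in nhds x0. \<forall>w. b \<bullet> w = 0 \<longrightarrow> w \<noteq> 0 \<longrightarrow> w \<bullet> (M x *v w) > 0"
    by (rule eventually_pos_on_hyperplane[OF cont[OF smM] bpos])
  moreover have "\<forall>\<^sub>F x in nhds x0. x \<in> S" using S by (rule eventually_nhds_in_open)
  ultimately have "\<forall>\<^sub>F x in nhds x0. \<beta> x > 0 \<and>
      (\<forall>w. b \<bullet> w = 0 \<longrightarrow> w \<noteq> 0 \<longrightarrow> w \<bullet> (M x *v w) > 0) \<and> x \<in> S"
    by (intro eventually_conj)
  then obtain T where T: "open T" "x0 \<in> T" "T \<subseteq> S" and \<beta>pos: "\<And>x. x \<in> T \<Longrightarrow> \<beta> x > 0"
    and Mpos: "\<And>x w. x \<in> T \<Longrightarrow> b \<bullet> w = 0 \<Longrightarrow> w \<noteq> 0 \<Longrightarrow> w \<bullet> (M x *v w) > 0"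
    unfolding eventually_nhds by blast
  define U where "U = {p \<in> cdom c. coord c p \<in> T}"
  have U: "openin X U" unfolding U_def by (rule openin_coord_preimage[OF cA T(1)])
  have Uc: "U \<subseteq> cdom c" unfolding U_def by blast
  have p0U: "p0 \<in> U" unfolding U_def using p0c T(2) unfolding x0_def by simp
  have UT: "coord c ` U = T" unfolding U_def using T(3) unfolding S_def by auto
  have cU: "c \<in> charts_at A p" "p \<in> topspace X" "chart_inv c (coord c p) = p" "coord c p \<in> T"
    "coord c p \<in> S" "M (coord c p) = components A gt c p" if "p \<in> U" for p
    using that Uc cA domX[OF cA] T(3) unfolding charts_at_def U_def M_def by auto
  have smT: "smooth_on T V" "smooth_on T \<beta>" "smooth_on T (\<lambda>x. det (M x))"
    using smooth_on_subset[OF _ T(3)] smV sm\<beta> smD by blast+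
  \<comment> \<open>With \<open>D = det (M x)\<close> one has
    \<open>gt(V, y) = D (b \<bullet> y) = - \<beta> D \<omega>(y)\<close>. As
    \<open>\<omega>(V) = -1\<close>, the requirement \<open>g(V, y) = \<omega>(y)\<close> forces
    \<open>f = 1 + \<beta> D\<close>.\<close>
  define F where "F = (\<lambda>x. 1 + \<beta> x * det (M x))"
  define f where "f = (\<lambda>p. F (coord c p))"
  define W where "W = (\<lambda>p. tvec_of A c p (V (coord c p)))"
  define L where "L = (\<lambda>p. {W p, tv_minus (W p)})"
  define \<omega> where "\<omega> = (\<lambda>p w. - (b \<bullet> w c) / \<beta> (coord c p))"
  define g where "g = (\<lambda>p x y. gt p x y - f p * (\<omega> p x * \<omega> p y))"
  have smF: "smooth_on T F"
    unfolding F_def by (intro smooth_on_add smooth_on_const smooth_on_mult smT T(1))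
  have sff: "smooth_fun A U f"
    by (rule smooth_funI[OF cA U Uc, of F]) (simp_all add: UT smF f_def)
  have sf\<beta>: "smooth_fun A U (\<lambda>p. \<beta> (coord c p))"
    by (rule smooth_funI[OF cA U Uc, of \<beta>]) (simp_all add: UT smT)
  have Wmem: "W p \<in> tangent_space A p" and Wc: "W p c = V (coord c p)" if "p \<in> U" for p
    using tvec_of_mem tvec_of_self cU(1)[OF that] unfolding W_def by blast+
  have svf: "smooth_vector_field A U W"
    unfolding W_def by (rule smooth_vector_fieldI[OF cA U Uc]) (simp add: UT smT)
  have \<omega>W: "\<omega> p (W p) = -1" if "p \<in> U" for p
    using \<beta>pos[OF cU(4)[OF that]] unfolding \<omega>_def Wc[OF that] by (simp add: \<beta>_def)
  have flatW: "g p (W p) y = \<omega> p y" if p: "p \<in> U" and y: "y \<in> tangent_space A p" for p y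
  proof -
    let ?x = "coord c p"
    have \<beta>0: "\<beta> ?x \<noteq> 0" using \<beta>pos[OF cU(4)[OF p]] by simp
    have "gt p (W p) y = V ?x \<bullet> (M ?x *v y c)"
      using bilinear_components[of p gt, OF Bt[OF cU(2)[OF p]] cU(1)[OF p] Wmem[OF p] y] Wc[OF p] cU(6)[OF p]
      by simp
    also have "\<dots> = det (M ?x) * (b \<bullet> y c)"
      using symmetric_matrix_inner[OF symM[OF cU(5)[OF p]], of "V ?x" "y c"] MV by (simp add: inner_commute)
    finally show ?thesis
      using \<beta>0 unfolding g_def \<omega>W[OF p] unfolding \<omega>_def f_def F_def by (simp add: field_simps)
  qed
  have gB: "symmetric_bilinear A p (g p)" if p: "p \<in> U" for p
  proof -
    have add: "\<omega> p (tv_add u v) = \<omega> p u + \<omega> p v" for u v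
      unfolding \<omega>_def tv_add_def by (simp add: inner_add_right add_divide_distrib diff_divide_distrib)
    have scale: "\<omega> p (tv_scale a u) = a * \<omega> p u" for a u
      unfolding \<omega>_def tv_scale_def by simp
    show ?thesis
      using Bt[OF cU(2)[OF p]] unfolding symmetric_bilinear_def g_def add scale
      by (simp add: algebra_simps)
  qed
  have gL: "lorentzian_at A g p" if p: "p \<in> U" for p
  proof -
    let ?x = "coord c p"
    note cp = cU(1)[OF p]
    let ?N = "components A g c p"
    have N: "x c \<bullet> (?N *v y c) = g p x y" if "x \<in> tangent_space A p" "y \<in> tangent_space A p" for x y
      using bilinear_components[of p g, OF gB[OF p] cp that] by simp
    have "V ?x \<bullet> (?N *v V ?x) = -1"
      using N[OF Wmem[OF p] Wmem[OF p]] flatW[OF p Wmem[OF p]] \<omega>W[OF p] Wc[OF p] by simp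
    \<comment> \<open>The \<open>g\<close>-complement of \<open>V\<close> is the kernel of \<omega>,
      that is the hyperplane orthogonal to \<open>b\<close>; there \<open>g\<close> agrees with
      \<open>gt\<close>, which is positive on \<open>T\<close>.\<close>
    moreover have "w \<bullet> (?N *v w) > 0" if w: "V ?x \<bullet> (?N *v w) = 0" "w \<noteq> 0" for w
    proof -
      let ?w = "tvec_of A c p w"
      have wm: "?w \<in> tangent_space A p" and wc: "?w c = w" using tvec_of_mem[OF cp] cp by auto
      have 0: "\<omega> p ?w = 0"
        using N[OF Wmem[OF p] wm] flatW[OF p wm] w(1) Wc[OF p] wc by simp
      then have "b \<bullet> w = 0" using \<beta>pos[OF cU(4)[OF p]] wc unfolding \<omega>_def by simp
      then have "w \<bullet> (M ?x *v w) > 0" using Mpos[OF cU(4)[OF p]] w(2) by blast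
      moreover have "gt p ?w ?w = w \<bullet> (M ?x *v w)"
        using bilinear_components[of p gt, OF Bt[OF cU(2)[OF p]] cp wm wm] wc cU(6)[OF p] by simp
      ultimately show ?thesis
        using N[OF wm wm] wc 0 unfolding g_def by simp
    qed
    ultimately obtain e :: "'n \<Rightarrow> real^'n" and k where "lorentz_basis ?N e k"
      using lorentz_basis_exists[OF transpose_components[of p g, OF gB[OF p] cp]] by metis
    then show ?thesis using lorentzian_at_iff[of p g, OF gB[OF p] cp] by blast
  qed
  have g_smooth: "smooth_on (coord c' ` (cdom c' \<inter> U)) (\<lambda>x. components A g c' (chart_inv c' x) $ i $ j)"
    if c': "c' \<in> A" for c' i j
  proof -
    let ?Y = "coord c' ` (cdom c' \<inter> U)"
    have Y: "open ?Y" by (rule open_coord_image[OF c' U])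
    have YU: "chart_inv c' x \<in> U" if "x \<in> ?Y" for x using that c' by auto
    \<comment> \<open>The components of \<omega> in the chart \<open>c'\<close>, obtained by
      expressing the coordinate vectors of \<open>c'\<close> in the chart \<open>c\<close>.\<close>
    define \<theta> where "\<theta> = (\<lambda>i x. - (b \<bullet> frechet_derivative (transition c' c) (at x) (axis i 1)) /
        \<beta> (coord c (chart_inv c' x)))"
    have sf: "smooth_on ?Y (\<lambda>x. f (chart_inv c' x))" "smooth_on ?Y (\<lambda>x. \<beta> (coord c (chart_inv c' x)))"
      using sff sf\<beta> c' unfolding smooth_fun_def o_def by auto
    have \<theta>: "smooth_on ?Y (\<theta> i)" for i
      unfolding \<theta>_def
    proof (intro smooth_on_divide smooth_on_minus smooth_on_inner smooth_on_const Y sf(2))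
      show "smooth_on ?Y (\<lambda>x. frechet_derivative (transition c' c) (at x) (axis i 1))"
        using Uc by (intro smooth_on_frechet_derivative smooth_on_subset[OF smooth_transition[OF c' cA]]) auto
      show "\<beta> (coord c (chart_inv c' x)) \<noteq> 0" if "x \<in> ?Y" for x
        using \<beta>pos[OF cU(4)[OF YU[OF that]]] by simp
    qed
    have "smooth_on (coord c' ` (cdom c' \<inter> topspace X)) (\<lambda>x. components A gt c' (chart_inv c' x) $ i $ j)"
      using gt c' unfolding symmetric_tensor_field_def by blast
    then have smt: "smooth_on ?Y (\<lambda>x. components A gt c' (chart_inv c' x) $ i $ j)"
      by (rule smooth_on_subset) (use cU(2) in auto)
    have "smooth_on ?Y (\<lambda>x. components A gt c' (chart_inv c' x) $ i $ j -
        f (chart_inv c' x) * (\<theta> i x * \<theta> j x))"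
      by (intro smooth_on_diff smooth_on_mult Y sf(1) smt \<theta>)
    then show ?thesis
    proof (rule smooth_on_cong[OF Y, rotated])
      fix x assume x: "x \<in> ?Y"
      let ?p = "chart_inv c' x"
      have "coord c' ?p = x" using x by (intro coord_chart_inv) auto
      then have "coord_vec A c' ?p i c = frechet_derivative (transition c' c) (at x) (axis i 1)" for i
        using cU(1)[OF YU[OF x]] unfolding coord_vec_def by simp
      then show "components A gt c' ?p $ i $ j - f ?p * (\<theta> i x * \<theta> j x) = components A g c' ?p $ i $ j"
        unfolding components_def g_def \<omega>_def \<theta>_def by simp
    qed
  qed
  have lm: "lorentzian_metric A U g"
    unfolding lorentzian_metric_def symmetric_tensor_field_def using gB gL g_smooth by blast
  have lef: "line_element_field X A U L"
    unfolding line_element_field_def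
  proof
    fix p assume p: "p \<in> U"
    have "W q \<noteq> tv_zero" if q: "q \<in> U" for q
    proof -
      have "V (coord c q) \<noteq> 0" using \<beta>pos[OF cU(4)[OF q]] unfolding \<beta>_def by auto
      then show ?thesis using Wc[OF q] by auto
    qed
    then show "\<exists>W' V. openin X W' \<and> p \<in> W' \<and> W' \<subseteq> U \<and> smooth_vector_field A W' V \<and>
        (\<forall>q\<in>W'. V q \<noteq> tv_zero \<and> L q = {V q, tv_minus (V q)})"
      using U p svf by (intro exI[of _ U] exI[of _ W]) (simp add: L_def)
  qed
  have Lp: "v = W p \<or> v = tv_scale (-1) (W p)" if "v \<in> L p" for v p
    using that unfolding L_def tv_minus_def tv_scale_def by auto
  have Lmem: "v \<in> tangent_space A p" if "v \<in> L p" "p \<in> U" for v p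
    using Lp[OF that(1)] Wmem[OF that(2)] tangent_space_scale[OF _ cU(1)[OF that(2)]] by blast
  \<comment> \<open>The two representatives differ by a sign \<open>s\<close>, which enters the
    tensor square only as \<open>s * s = 1\<close>.\<close>
  have Lflat: "\<exists>s\<in>{1,-1}. \<forall>x\<in>tangent_space A p. g p v x = s * \<omega> p x"
    if v: "v \<in> L p" and p: "p \<in> U" for v p
    using Lp[OF v]
  proof
    assume "v = W p"
    then show ?thesis using flatW[OF p] by auto
  next
    assume "v = tv_scale (-1) (W p)"
    moreover have "g p (tv_scale (-1) (W p)) x = - g p (W p) x" if "x \<in> tangent_space A p" for x
      using gB[OF p] Wmem[OF p] that unfolding symmetric_bilinear_def by force
    ultimately show ?thesis using flatW[OF p] by auto
  qed
  have tp: "transformation_prescription X A U gt g L f"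
    unfolding transformation_prescription_def
  proof (intro conjI lm lef sff ballI)
    fix p v assume p: "p \<in> U" and v: "v \<in> L p"
    obtain s where s: "s \<in> {1, -1}" "\<forall>x\<in>tangent_space A p. g p v x = s * \<omega> p x"
      using Lflat[OF v p] by blast
    show "g p v v = -1"
      using Lp[OF v]
    proof
      assume "v = W p"
      then show ?thesis using flatW[OF p Wmem[OF p]] \<omega>W[OF p] by simp
    next
      assume v': "v = tv_scale (-1) (W p)"
      have "g p v v = s * \<omega> p v" using s(2) Lmem[OF v p] by blast
      moreover have "\<omega> p v = 1" using \<omega>W[OF p] unfolding v' \<omega>_def tv_scale_def by simp
      moreover have "g p v (W p) = s * \<omega> p (W p)" using s(2) Wmem[OF p] by blast
      moreover have "g p v (W p) = 1"
        using gB[OF p] Wmem[OF p] flatW[OF p Wmem[OF p]] \<omega>W[OF p]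
        unfolding v' symmetric_bilinear_def by force
      ultimately show ?thesis using \<omega>W[OF p] by simp
    qed
    fix x y assume xy: "x \<in> tangent_space A p" "y \<in> tangent_space A p"
    have "flat g p v x * flat g p v y = \<omega> p x * \<omega> p y"
      unfolding flat_def using s xy by auto
    then show "gt p x y = g p x y + f p * (flat g p v x * flat g p v y)"
      unfolding g_def by simp
  qed
  have f1: "f q = 1 \<longleftrightarrow> det (components A gt c q) = 0" if "q \<in> U" for q
    using \<beta>pos[OF cU(4)[OF that]] cU(6)[OF that] unfolding f_def F_def by simp
  have H: "{q \<in> U. f q = 1} = degeneracy_locus X A gt \<inter> U"
    using f1 degeneracy_locus_iff[OF gt cU(1)] by auto
  have df: "differential_nonzero A f q \<and> (\<forall>v\<in>L q. differential A f q v \<noteq> 0)"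
    if q: "q \<in> U" "f q = 1" for q
  proof -
    let ?x = "coord c q"
    note cq = cU(1)[OF q(1)]
    have d: "det (components A gt c q) = 0" using f1 q by blast
    have qH: "q \<in> degeneracy_locus X A gt" using degeneracy_locus_iff[OF gt cq] d by blast
    have dM: "det (M ?x) = 0" using d cU(6)[OF q(1)] by simp
    define D' where "D' = frechet_derivative (\<lambda>x. det (M x)) (at ?x)"
    have D': "((\<lambda>x. det (M x)) has_derivative D') (at ?x)"
      unfolding D'_def by (rule smooth_on_has_derivative[OF smD cU(5)[OF q(1)]])
    have linD: "linear D'" using D' has_derivative_linear by blast
    \<comment> \<open>The derivative of \<beta> drops out because it is multiplied by
      \<open>det (M ?x) = 0\<close>.\<close>
    have "(F has_derivative (\<lambda>h. \<beta> ?x * D' h)) (at ?x)"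
      unfolding F_def
      by (auto intro!: derivative_eq_intros D' smooth_on_has_derivative[OF sm\<beta> cU(5)[OF q(1)]] simp: dM)
    then have F': "((f \<circ> chart_inv c) has_derivative (\<lambda>h. \<beta> ?x * D' h)) (at ?x)"
    proof (rule has_derivative_transform_within_open[OF _ T(1) cU(4)[OF q(1)]])
      fix x assume "x \<in> T"
      then show "F x = (f \<circ> chart_inv c) x"
        using T(3) unfolding f_def S_def by (simp add: coord_chart_inv subset_iff)
    qed
    have \<beta>x: "\<beta> ?x \<noteq> 0" using \<beta>pos[OF cU(4)[OF q(1)]] by simp
    obtain h where h: "D' h \<noteq> 0" using Dnz[OF cU(5)[OF q(1)] dM] unfolding D'_def by blast
    \<comment> \<open>Otherwise \<open>dD\<close> would vanish on the radical, which
      \<open>V\<close> spans, and on vectors tangent to the degeneracy locus, where \<open>D\<close>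
      is constantly 0. By the decomposition it would vanish on the whole tangent space, against
      transversality of the metric.\<close>
    have "D' (V ?x) \<noteq> 0"
    proof
      assume DV: "D' (V ?x) = 0"
      have "D' (w c) = 0" if w: "w \<in> tangent_space A q" for w
      proof -
        have "q \<in> degeneracy_locus X A gt \<inter> topspace X" using qH cU(2)[OF q(1)] by blast
        then obtain u v where u: "u \<in> radical A gt q"
          and v: "v \<in> tangent_space_of X A (degeneracy_locus X A gt \<inter> topspace X) q" and wuv: "w = tv_add u v"
          using tr w unfolding transverse_radical_def by blast
        have "D' (v c) = 0"
        proof (rule tangent_space_of_kernel[OF v cq])
          show "(((\<lambda>p. det (components A gt c p)) \<circ> chart_inv c) has_derivative D') (at ?x)"
            unfolding D'_def by (rule derD[OF cU(5)[OF q(1)]])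
          show "det (components A gt c p) = 0"
            if "p \<in> degeneracy_locus X A gt \<inter> topspace X" "p \<in> cdom c" for p
          proof -
            have "c \<in> charts_at A p" using that(2) cA unfolding charts_at_def by simp
            then show ?thesis using degeneracy_locus_iff[OF gt] that(1) by blast
          qed
        qed
        moreover obtain r where "u c = r *\<^sub>R V ?x"
        proof (rule radical_adjugate[where gt = gt, OF Bt[OF cU(2)[OF q(1)]] cq d _ u])
          show "adjugate_mv (components A gt c q) b \<noteq> 0"
            using \<beta>x cU(6)[OF q(1)] unfolding \<beta>_def V_def by auto
        qed (use cU(6)[OF q(1)] in \<open>auto simp: V_def\<close>)
        ultimately show ?thesis
          unfolding wuv using DV linD by (simp add: tv_add_def linear_add linear_cmul)
      qed
      from this[OF tvec_of_mem[OF cq, of h]] show False using h cq by simp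
    qed
    then have "differential A f q v \<noteq> 0" if "v \<in> L q" for v
      using Lp[OF that] differential_eq[OF cq F' Lmem[OF that q(1)]] Wc[OF q(1)] \<beta>x linD
      by (auto simp: tv_scale_def linear_neg)
    moreover have "differential_nonzero A f q"
      using differential_nonzero_iff[OF cq F'] h \<beta>x by auto
    ultimately show ?thesis by blast
  qed
  show ?thesis
    by (intro exI[of _ U] exI[of _ g] exI[of _ L] exI[of _ f] conjI[OF U] conjI[OF p0U] conjI[OF tp]
        conjI[OF H]) (use df in blast)
qed

end

section \<open>Choice of the neighbourhood\<close>

theorem theorem1p5:
  fixes X :: "'a topology"
    and A :: "('a, 'n::finite) chart set"
    and gt :: "('a, 'n) tensor2"
    and p0 :: 'a
  assumes "smooth_manifold X A"
    and "CARD('n) \<ge> 2"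
    and "signature_type_changing X A gt"
    and "p0 \<in> topspace X"
  shows "\<exists>U. openin X U \<and> p0 \<in> U \<and>
    (transverse_type_changing X A U gt \<and> transverse_radical X A U gt
     \<longleftrightarrow>
     (\<exists>g L f. transformation_prescription X A U gt g L f \<and>
        {q \<in> U. f q = 1} = degeneracy_locus X A gt \<inter> U \<and>
        (\<forall>q \<in> {q \<in> U. f q = 1}.
           differential_nonzero A f q \<and> (\<forall>v\<in>L q. differential A f q v \<noteq> 0))))"
    (is "\<exists>U. openin X U \<and> p0 \<in> U \<and> (?P U \<longleftrightarrow> ?Q U)")
proof -
  interpret smooth_atlas X A
    using assms(1) unfolding smooth_manifold_def by unfold_locales blast
  have gt: "symmetric_tensor_field A (topspace X) gt"
    using assms(3) unfolding signature_type_changing_def by blast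
  have QP: "?P U" if U: "openin X U" "?Q U" for U
  proof -
    obtain g L f where *: "transformation_prescription X A U gt g L f"
      "{q \<in> U. f q = 1} = degeneracy_locus X A gt \<inter> U"
      "\<forall>q \<in> {q \<in> U. f q = 1}. differential_nonzero A f q \<and> (\<forall>v\<in>L q. differential A f q v \<noteq> 0)"
      using U(2) by blast
    show ?thesis
      by (rule prescription_imp_transverse[OF gt U(1) *(1,2)]) (use *(3) in blast)
  qed
  show ?thesis
  \<comment> \<open>If (1) holds on all of the manifold, the local construction gives a
    \<open>U\<close> with (2), and \<open>QP\<close> returns (1) on that \<open>U\<close>. If (1)
    fails globally, the whole space is a valid neighbourhood: there (1) is false, and by
    \<open>QP\<close> so is (2).\<close>
  proof (cases "?P (topspace X)")
    case True
    then obtain U where U: "openin X U" "p0 \<in> U" "?Q U"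
      using transverse_imp_prescription[OF assms(3,4)] by blast
    then show ?thesis using QP[OF U(1,3)] by blast
  next
    case False
    then show ?thesis using QP[of "topspace X"] assms(4) by (intro exI[of _ "topspace X"]) blast
  qed
qed

end
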